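(* Let $E$ be a complex Banach space with a Schauder basis. The following assertions are equivalent: (a) $E$ is reflexive. (b) Every power-bounded operator $T\in\mathscr{L}(E)$ such that the set $\{T^{n+1}x-T^nx \mid n\in\mathbb{N}\}$ is relatively compact in $E$ for every $x\in E$ is almost periodic, i.e., the orbit $\{T^nx\mid n\in\mathbb{N}\}$ is relatively compact in $E$ for every $x\in E$.
   Context: $\mathscr{L}(E)$ denotes the space of bounded linear operators on the Banach space $E$. An operator $T\in\mathscr{L}(E)$ is power-bounded if $\sup_{n\in\mathbb{N}}\|T^n\|<\infty$. Relative compactness is with respect to the norm topology. *)

theory Defs
  imports "HOL-Analysis.Analysis"
begin

section \<open>Complex normed and complex Banach spaces\<close>

text \<open>
  The normed spaces of HOL-Analysis are real. A complex one is a real normed space with a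
  complex scalar multiplication that extends the real one and for which the norm is homogeneous.
\<close>

class scaleC = scaleR +
  fixes scaleC :: "complex \<Rightarrow> 'a \<Rightarrow> 'a" (infixr "*\<^sub>C" 75)

class complex_normed_vector = real_normed_vector + scaleC +
  assumes scaleC_add_right: "a *\<^sub>C (x + y) = a *\<^sub>C x + a *\<^sub>C y"
    and scaleC_add_left: "(a + b) *\<^sub>C x = a *\<^sub>C x + b *\<^sub>C x"
    and scaleC_scaleC: "a *\<^sub>C b *\<^sub>C x = (a * b) *\<^sub>C x"
    and scaleC_one: "1 *\<^sub>C x = x"
    and scaleC_of_real: "complex_of_real r *\<^sub>C x = r *\<^sub>R x"
    and norm_scaleC: "norm (a *\<^sub>C x) = cmod a * norm x"

class complex_banach = complex_normed_vector + banach

instantiation complex :: complex_banach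
begin

definition scaleC_complex :: "complex \<Rightarrow> complex \<Rightarrow> complex"
  where "scaleC_complex a x = a * x"

instance
  by standard (auto simp: scaleC_complex_def algebra_simps norm_mult scaleR_conv_of_real)

end


section \<open>Bounded complex-linear operators\<close>

definition bounded_clinear :: "('a::complex_normed_vector \<Rightarrow> 'b::complex_normed_vector) \<Rightarrow> bool"
  where "bounded_clinear f \<longleftrightarrow> bounded_linear f \<and> (\<forall>c x. f (c *\<^sub>C x) = c *\<^sub>C f x)"

lemma bounded_clinear_zero: "bounded_clinear (\<lambda>x. 0)"
  unfolding bounded_clinear_def
  by (metis bounded_linear_zero norm_scaleC norm_zero mult_zero_right norm_eq_zero)

lemma bounded_linear_scaleC: "bounded_linear (\<lambda>x::'a::complex_normed_vector. c *\<^sub>C x)"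
proof (rule bounded_linear_intro[where K = "cmod c"])
  fix x y :: 'a and r :: real
  show "c *\<^sub>C (x + y) = c *\<^sub>C x + c *\<^sub>C y"
    by (rule scaleC_add_right)
  show "c *\<^sub>C (r *\<^sub>R x) = r *\<^sub>R (c *\<^sub>C x)"
    by (simp add: scaleC_of_real[symmetric] scaleC_scaleC mult.commute)
  show "norm (c *\<^sub>C x) \<le> norm x * cmod c"
    by (simp add: norm_scaleC mult.commute)
qed

lemma scaleC_minus_right: "c *\<^sub>C (- x) = - (c *\<^sub>C (x::'a::complex_normed_vector))"
  by (rule linear_neg[OF bounded_linear.linear[OF bounded_linear_scaleC]])

lemma scaleC_diff_right: "c *\<^sub>C (x - y) = c *\<^sub>C x - c *\<^sub>C (y::'a::complex_normed_vector)"
  by (rule linear_diff[OF bounded_linear.linear[OF bounded_linear_scaleC]])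

lemma scaleC_left_commute:
  "a *\<^sub>C b *\<^sub>C x = b *\<^sub>C a *\<^sub>C (x::'a::complex_normed_vector)"
  by (simp add: scaleC_scaleC mult.commute)

typedef (overloaded) ('a, 'b) cblinfun ("(_ \<Rightarrow>\<^sub>C\<^sub>L /_)" [22, 21] 21) =
  "{f :: 'a::complex_normed_vector \<Rightarrow> 'b::complex_normed_vector. bounded_clinear f}"
  morphisms cblinfun_apply CBlinfun
  using bounded_clinear_zero by blast

setup_lifting type_definition_cblinfun

instantiation cblinfun :: (complex_normed_vector, complex_normed_vector) complex_normed_vector
begin

lift_definition norm_cblinfun :: "'a \<Rightarrow>\<^sub>C\<^sub>L 'b \<Rightarrow> real" is onorm .

lift_definition zero_cblinfun :: "'a \<Rightarrow>\<^sub>C\<^sub>L 'b" is "\<lambda>x. 0"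
  by (rule bounded_clinear_zero)

lift_definition plus_cblinfun :: "'a \<Rightarrow>\<^sub>C\<^sub>L 'b \<Rightarrow> 'a \<Rightarrow>\<^sub>C\<^sub>L 'b \<Rightarrow> 'a \<Rightarrow>\<^sub>C\<^sub>L 'b" is "\<lambda>f g x. f x + g x"
  by (simp add: bounded_clinear_def bounded_linear_add scaleC_add_right)

lift_definition minus_cblinfun :: "'a \<Rightarrow>\<^sub>C\<^sub>L 'b \<Rightarrow> 'a \<Rightarrow>\<^sub>C\<^sub>L 'b \<Rightarrow> 'a \<Rightarrow>\<^sub>C\<^sub>L 'b" is "\<lambda>f g x. f x - g x"
  by (simp add: bounded_clinear_def bounded_linear_sub scaleC_diff_right)

lift_definition uminus_cblinfun :: "'a \<Rightarrow>\<^sub>C\<^sub>L 'b \<Rightarrow> 'a \<Rightarrow>\<^sub>C\<^sub>L 'b" is "\<lambda>f x. - f x"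
  by (simp add: bounded_clinear_def bounded_linear_minus scaleC_minus_right)

lift_definition scaleC_cblinfun :: "complex \<Rightarrow> 'a \<Rightarrow>\<^sub>C\<^sub>L 'b \<Rightarrow> 'a \<Rightarrow>\<^sub>C\<^sub>L 'b" is "\<lambda>c f x. c *\<^sub>C f x"
  unfolding bounded_clinear_def
  by (auto intro: bounded_linear_compose[OF bounded_linear_scaleC] scaleC_left_commute)

lift_definition scaleR_cblinfun :: "real \<Rightarrow> 'a \<Rightarrow>\<^sub>C\<^sub>L 'b \<Rightarrow> 'a \<Rightarrow>\<^sub>C\<^sub>L 'b" is "\<lambda>r f x. r *\<^sub>R f x"
  unfolding bounded_clinear_def scaleC_of_real[symmetric]
  by (auto intro: bounded_linear_compose[OF bounded_linear_scaleC] scaleC_left_commute)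

definition dist_cblinfun :: "'a \<Rightarrow>\<^sub>C\<^sub>L 'b \<Rightarrow> 'a \<Rightarrow>\<^sub>C\<^sub>L 'b \<Rightarrow> real"
  where "dist_cblinfun f g = norm (f - g)"

definition sgn_cblinfun :: "'a \<Rightarrow>\<^sub>C\<^sub>L 'b \<Rightarrow> 'a \<Rightarrow>\<^sub>C\<^sub>L 'b"
  where "sgn_cblinfun f = inverse (norm f) *\<^sub>R f"

definition uniformity_cblinfun :: "(('a \<Rightarrow>\<^sub>C\<^sub>L 'b) \<times> ('a \<Rightarrow>\<^sub>C\<^sub>L 'b)) filter"
  where "uniformity_cblinfun = (INF e\<in>{0 <..}. principal {(f, g). dist f g < e})"

definition open_cblinfun :: "('a \<Rightarrow>\<^sub>C\<^sub>L 'b) set \<Rightarrow> bool"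
  where "open_cblinfun S \<longleftrightarrow> (\<forall>f\<in>S. \<forall>\<^sub>F (f', g) in uniformity. f' = f \<longrightarrow> g \<in> S)"

instance
proof
  fix f g h :: "'a \<Rightarrow>\<^sub>C\<^sub>L 'b" and a b :: complex and r s :: real
  show "f + g + h = f + (g + h)" "f + g = g + f" "0 + f = f" "- f + f = 0" "f - g = f + - g"
    by (transfer, simp add: add_ac)+
  show "r *\<^sub>R (f + g) = r *\<^sub>R f + r *\<^sub>R g" "(r + s) *\<^sub>R f = r *\<^sub>R f + s *\<^sub>R f"
    "r *\<^sub>R s *\<^sub>R f = (r * s) *\<^sub>R f" "1 *\<^sub>R f = f"
    by (transfer, simp add: scaleR_add_right scaleR_add_left)+
  show "a *\<^sub>C (f + g) = a *\<^sub>C f + a *\<^sub>C g" "(a + b) *\<^sub>C f = a *\<^sub>C f + b *\<^sub>C f"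
    "a *\<^sub>C b *\<^sub>C f = (a * b) *\<^sub>C f" "1 *\<^sub>C f = f" "complex_of_real r *\<^sub>C f = r *\<^sub>R f"
    by (transfer, simp add: scaleC_add_right scaleC_add_left scaleC_scaleC scaleC_one scaleC_of_real)+
  show "dist f g = norm (f - g)" "sgn f = inverse (norm f) *\<^sub>R f"
    "uniformity = (INF e\<in>{0 <..}. principal {(f, g :: 'a \<Rightarrow>\<^sub>C\<^sub>L 'b). dist f g < e})"
    by (fact dist_cblinfun_def sgn_cblinfun_def uniformity_cblinfun_def)+
  show "open S \<longleftrightarrow> (\<forall>f\<in>S. \<forall>\<^sub>F (f', g) in uniformity. f' = f \<longrightarrow> g \<in> S)" for S :: "('a \<Rightarrow>\<^sub>C\<^sub>L 'b) set"
    by (fact open_cblinfun_def)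
  show "norm f = 0 \<longleftrightarrow> f = 0"
    by transfer (auto simp: bounded_clinear_def onorm_eq_0)
  show "norm (f + g) \<le> norm f + norm g"
    by transfer (auto simp: bounded_clinear_def intro: onorm_triangle)
  show "norm (r *\<^sub>R f) = \<bar>r\<bar> * norm f"
    by transfer (auto simp: bounded_clinear_def onorm_scaleR)
  show "norm (a *\<^sub>C f) = cmod a * norm f"
  proof transfer
    fix a :: complex and f :: "'a \<Rightarrow> 'b"
    assume "bounded_clinear f"
    then have "bounded_linear f"
      by (simp add: bounded_clinear_def)
    have "onorm (\<lambda>x. a *\<^sub>C f x) = onorm (\<lambda>x. cmod a *\<^sub>R f x)"
      by (simp add: onorm_def norm_scaleC)
    also have "\<dots> = cmod a * onorm f"
      using onorm_scaleR[OF \<open>bounded_linear f\<close>, of "cmod a"] by simp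
    finally show "onorm (\<lambda>x. a *\<^sub>C f x) = cmod a * onorm f" .
  qed
qed

end


section \<open>Reflexivity and Schauder bases\<close>

type_synonym 'a cdual = "'a \<Rightarrow>\<^sub>C\<^sub>L complex"

lift_definition canonical_embedding :: "'a::complex_normed_vector \<Rightarrow> 'a cdual cdual"
  is "\<lambda>x f. cblinfun_apply f x"
proof -
  fix x :: 'a
  have "bounded_linear (\<lambda>f::'a cdual. cblinfun_apply f x)"
  proof (rule bounded_linear_intro[where K = "norm x"])
    fix f g :: "'a cdual" and r :: real
    show "cblinfun_apply (f + g) x = cblinfun_apply f x + cblinfun_apply g x"
      "cblinfun_apply (r *\<^sub>R f) x = r *\<^sub>R cblinfun_apply f x"
      by (transfer, simp)+
    show "norm (cblinfun_apply f x) \<le> norm f * norm x"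
      by transfer (simp add: bounded_clinear_def onorm)
  qed
  moreover have "cblinfun_apply (c *\<^sub>C f) x = c *\<^sub>C cblinfun_apply f x"
    for c and f :: "'a cdual"
    by transfer simp
  ultimately show "bounded_clinear (\<lambda>f::'a cdual. cblinfun_apply f x)"
    by (simp add: bounded_clinear_def)
qed

definition reflexive_space :: "'a::complex_normed_vector itself \<Rightarrow> bool"
  where "reflexive_space (_ :: 'a itself) \<longleftrightarrow> surj (canonical_embedding :: 'a \<Rightarrow> 'a cdual cdual)"

text \<open>
  Bases are indexed by all natural numbers, and the expansion need only converge in the given
  order. Uniqueness of the coefficients makes a space with such a basis infinite-dimensional.
\<close>

definition schauder_basis :: "(nat \<Rightarrow> 'a::complex_normed_vector) \<Rightarrow> bool"
  where "schauder_basis e \<longleftrightarrow> (\<forall>x. \<exists>!a :: nat \<Rightarrow> complex. (\<lambda>n. a n *\<^sub>C e n) sums x)"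


section \<open>Power-bounded and almost periodic operators\<close>

definition power_bounded :: "('a::complex_normed_vector \<Rightarrow>\<^sub>C\<^sub>L 'a) \<Rightarrow> bool"
  where "power_bounded T \<longleftrightarrow> bdd_above (range (\<lambda>n::nat. onorm (cblinfun_apply T ^^ n)))"

definition relatively_compact :: "'a::topological_space set \<Rightarrow> bool"
  where "relatively_compact S \<longleftrightarrow> compact (closure S)"

definition almost_periodic :: "('a::complex_normed_vector \<Rightarrow>\<^sub>C\<^sub>L 'a) \<Rightarrow> bool"
  where "almost_periodic T \<longleftrightarrow>
    (\<forall>x. relatively_compact (range (\<lambda>n::nat. (cblinfun_apply T ^^ n) x)))"

end

theory Submission
  imports Defs
begin

text \<open>
  \<^bold>\<open>Reflexive spaces.\<close> By the mean ergodic theorem every \<open>x\<close> splits as \<open>x\<^sub>0 + y\<close> with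
  \<open>T x\<^sub>0 = x\<^sub>0\<close> and \<open>y\<close> in the closure of the range of \<open>1 - T\<close> (\<open>mean_ergodic_decomposition\<close>). The
  orbit of \<open>z - T z\<close> is, up to sign, the sequence of differences of the orbit of \<open>z\<close>, hence
  relatively compact by hypothesis; power-boundedness carries this over to the closure, and adding
  \<open>x\<^sub>0\<close> only translates the orbit (\<open>reflexive_almost_periodic\<close>).

  \<^bold>\<open>Nonreflexive spaces.\<close> By James's criterion (\<open>reflexive_if_shrinking_boundedly_complete\<close>) the
  basis is not boundedly complete or not shrinking. Both defects give the same picture
  (\<open>escaping_system\<close>): increasing, uniformly bounded, commuting projections \<open>S\<^sub>n\<close> converging strongly
  to the identity, a bounded divergent sequence \<open>u\<^sub>n\<close> with \<open>S\<^sub>m u\<^sub>n = u\<^sub>m\<close> for \<open>m \<le> n\<close>, and a functional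
  \<open>g\<close> with \<open>g \<circ> S\<^sub>n = g\<close> and \<open>g u\<^sub>n = 1\<close>. The sequence \<open>u\<^sub>n\<close> plays the role of the sections
  \<open>S\<^sub>n s\<close> of a vector \<open>s\<close> that lies in the bidual but not in the space. If bounded completeness
  fails, \<open>S\<^sub>n\<close> and \<open>u\<^sub>n\<close> are partial sums and \<open>g\<close> is a multiple of a coordinate functional. If a
  functional \<open>f\<close> witnesses that the basis is not shrinking, there are bounded blocks \<open>u\<^sub>n\<close> with
  \<open>f u\<^sub>n = 1\<close> (\<open>normalised_blocks_if_not_shrinking\<close>), and tilting the partial sum projections along
  them, \<open>S\<^sub>n x = P\<^sub>n x + f (x - P\<^sub>n x) u\<^sub>n\<close>, makes these blocks coherent, with \<open>g = f\<close>. For the unit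
  vectors of \<open>\<ell>\<^sup>1\<close> and the sum functional this is the passage to the basis
  \<open>e\<^sub>1, e\<^sub>2 - e\<^sub>1, e\<^sub>3 - e\<^sub>2, \<dots>\<close>.

  On such a system let \<open>L\<close> be the average of the projections \<open>1 - S\<^sub>n\<close> with weights \<open>2\<^sup>-\<^sup>n\<^sup>-\<^sup>1\<close>. Its
  powers are bounded and tend strongly to \<open>0\<close>. The affine map with linear part \<open>L\<close> and fixed point \<open>s\<close>
  preserves the space, because \<open>v = s - L s\<close> is the average of the vectors \<open>u\<^sub>n\<close> and so lies in it;
  its iterates are bounded and their increments tend to \<open>0\<close>, yet their sections converge to those
  of the missing point \<open>s\<close>, so no subsequence of them converges. The operator
  \<open>T x = L x + g x v\<close> acts on the invariant hyperplane \<open>g = 1\<close> as this affine map (\<open>operator_with_escaping_orbit\<close>).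

  The functional-analytic tools are the Hahn-Banach theorem (\<open>sublinear_dominates_linear\<close>) and the
  uniform boundedness of the partial sum projections of a Schauder basis
  (\<open>partial_uniformly_bounded\<close>).
\<close>

section \<open>Sublinear functionals and the Hahn-Banach theorem\<close>

text \<open>
  The inequality for scaling, applied to \<open>r\<close> and \<open>1 / r\<close>, gives positive homogeneity; the
  inequality is the form that passes to infima directly.
\<close>

definition sublinear :: "('a::real_vector \<Rightarrow> real) \<Rightarrow> bool"
  where "sublinear p \<longleftrightarrow>
    (\<forall>x y. p (x + y) \<le> p x + p y) \<and> (\<forall>r>0. \<forall>x. p (r *\<^sub>R x) \<le> r * p x)"

lemma sublinear_add: "sublinear p \<Longrightarrow> p (x + y) \<le> p x + p y"
  by (simp add: sublinear_def)

lemma sublinear_scale_le: "sublinear p \<Longrightarrow> r > 0 \<Longrightarrow> p (r *\<^sub>R x) \<le> r * p x"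
  by (simp add: sublinear_def)

lemma sublinear_zero:
  assumes "sublinear p"
  shows "p 0 = 0"
  using sublinear_scale_le[OF assms, of 2 0] sublinear_scale_le[OF assms, of "1/2" 0] by simp

lemma sublinear_scale:
  assumes "sublinear p" "r \<ge> 0"
  shows "p (r *\<^sub>R x) = r * p x"
proof (cases "r = 0")
  case True
  then show ?thesis using sublinear_zero[OF assms(1)] by simp
next
  case False
  then have r: "r > 0" using assms(2) by simp
  have "p x = p ((1/r) *\<^sub>R r *\<^sub>R x)" using r by simp
  also have "\<dots> \<le> (1/r) * p (r *\<^sub>R x)" using r by (intro sublinear_scale_le[OF assms(1)]) simp
  finally have "r * p x \<le> p (r *\<^sub>R x)" using r by (simp add: field_simps)
  then show ?thesis using sublinear_scale_le[OF assms(1) r, of x] by simp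
qed

lemma sublinear_lower: "sublinear p \<Longrightarrow> - p (- x) \<le> p x"
  using sublinear_add[of p x "-x"] sublinear_zero[of p] by simp

text \<open>
  The witness is the largest sublinear minorant \<open>q\<close> of \<open>p\<close> with \<open>q (- x\<^sub>0) = - p x\<^sub>0\<close>: subadditivity
  forces \<open>q x \<le> p (x + t x\<^sub>0) - t p x\<^sub>0\<close> for \<open>t \<ge> 0\<close>, and the infimum of these bounds is sublinear. If \<open>p\<close>
  is minimal, \<open>q = p\<close> for every \<open>x\<^sub>0\<close>, so \<open>p\<close> is odd; tilting before minimising instead fixes the value
  at one prescribed point.
\<close>

lemma sublinear_tilt:
  fixes x0 :: "'a::real_vector"
  assumes p: "sublinear p"
  shows "\<exists>q. sublinear q \<and> (\<forall>x. q x \<le> p x) \<and> q (- x0) \<le> - p x0"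
proof -
  define g where "g x t = p (x + t *\<^sub>R x0) - t * p x0" for x t
  define q where "q x = (INF t\<in>{0..}. g x t)" for x
  have lower: "- p (- x) \<le> g x t" if "t \<ge> 0" for x t
    using sublinear_add[OF p, of "x + t *\<^sub>R x0" "- x"] sublinear_scale[OF p that, of x0]
    by (simp add: g_def)
  have bdd: "bdd_below (g x ` {0..})" for x
    by (rule bdd_belowI2[where m = "- p (- x)"]) (auto intro: lower)
  have le: "q x \<le> g x t" if "t \<ge> 0" for x t
    unfolding q_def by (rule cINF_lower[OF bdd]) (use that in auto)
  have ge: "c \<le> q x" if "\<And>t. t \<ge> 0 \<Longrightarrow> c \<le> g x t" for c x
    unfolding q_def by (rule cINF_greatest) (use that in auto)
  have "q (x + y) \<le> q x + q y" for x y
  proof -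
    have *: "q (x + y) \<le> g x s + g y t" if "s \<ge> 0" "t \<ge> 0" for s t
    proof -
      have "q (x + y) \<le> g (x + y) (s + t)"
        using that by (intro le) simp
      also have "\<dots> \<le> g x s + g y t"
        using sublinear_add[OF p, of "x + s *\<^sub>R x0" "y + t *\<^sub>R x0"]
        by (simp add: g_def algebra_simps)
      finally show ?thesis .
    qed
    have "q (x + y) - q y \<le> g x s" if "s \<ge> 0" for s
    proof -
      have "q (x + y) - g x s \<le> q y"
        by (rule ge) (use *[OF that] in \<open>simp add: algebra_simps\<close>)
      then show ?thesis by simp
    qed
    then have "q (x + y) - q y \<le> q x" by (rule ge)
    then show ?thesis by simp
  qed
  moreover have "q (r *\<^sub>R x) \<le> r * q x" if r: "r > 0" for r x
  proof -
    have "q (r *\<^sub>R x) / r \<le> g x t" if "t \<ge> 0" for t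
    proof -
      have "q (r *\<^sub>R x) \<le> g (r *\<^sub>R x) (r * t)"
        using that r by (intro le) simp
      also have "\<dots> = r * g x t"
        using sublinear_scale[OF p, of r "x + t *\<^sub>R x0"] r by (simp add: g_def algebra_simps)
      finally show ?thesis using r by (simp add: field_simps)
    qed
    then have "q (r *\<^sub>R x) / r \<le> q x" by (rule ge)
    then show ?thesis using r by (simp add: field_simps)
  qed
  moreover have "q x \<le> p x" for x
    using le[of 0 x] by (simp add: g_def)
  moreover have "q (- x0) \<le> - p x0"
    using le[of 1 "- x0"] sublinear_zero[OF p] by (simp add: g_def)
  ultimately show ?thesis
    unfolding sublinear_def by blast
qed

lemma sublinear_chain_INF:
  fixes p :: "'a::real_vector \<Rightarrow> real"
  assumes ne: "C \<noteq> {}" and sub: "\<And>q. q \<in> C \<Longrightarrow> sublinear q \<and> (\<forall>x. q x \<le> p x)"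
    and chain: "\<And>q r. q \<in> C \<Longrightarrow> r \<in> C \<Longrightarrow> (\<forall>x. q x \<le> r x) \<or> (\<forall>x. r x \<le> q x)"
  defines "m \<equiv> \<lambda>x. INF q\<in>C. q x"
  shows "sublinear m" "\<And>x q. q \<in> C \<Longrightarrow> m x \<le> q x"
proof -
  have bdd: "bdd_below ((\<lambda>q. q x) ` C)" for x
  proof (rule bdd_belowI2[where m = "- p (- x)"])
    fix q assume "q \<in> C"
    then show "- p (- x) \<le> q x"
      using sublinear_lower[of q x] sub[of q] by (smt (verit))
  qed
  show le: "m x \<le> q x" if "q \<in> C" for q x
    unfolding m_def by (rule cINF_lower[OF bdd that])
  have ge: "c \<le> m x" if "\<And>q. q \<in> C \<Longrightarrow> c \<le> q x" for c x
    unfolding m_def by (rule cINF_greatest[OF ne that])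
  show "sublinear m"
    unfolding sublinear_def
  proof (intro conjI allI impI)
    fix x y
    have *: "m (x + y) \<le> q x + r y" if "q \<in> C" "r \<in> C" for q r
    proof (cases "\<forall>x. q x \<le> r x")
      case True
      then show ?thesis
        using le[OF that(1), of "x + y"] sub[OF that(1)] sublinear_add[of q x y] by (smt (verit))
    next
      case False
      then have "\<forall>x. r x \<le> q x" using chain[OF that] by blast
      then show ?thesis
        using le[OF that(2), of "x + y"] sub[OF that(2)] sublinear_add[of r x y] by (smt (verit))
    qed
    have "m (x + y) - m y \<le> q x" if "q \<in> C" for q
    proof -
      have "m (x + y) - q x \<le> m y"
        by (rule ge) (use *[OF that] in \<open>simp add: algebra_simps\<close>)
      then show ?thesis by simp
    qed
    then have "m (x + y) - m y \<le> m x" by (rule ge)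
    then show "m (x + y) \<le> m x + m y" by simp
  next
    fix r :: real and x :: 'a assume r: "r > 0"
    have "m (r *\<^sub>R x) / r \<le> q x" if "q \<in> C" for q
      using le[OF that, of "r *\<^sub>R x"] sub[OF that] sublinear_scale_le[of q r x] r
      by (simp add: field_simps)
    then have "m (r *\<^sub>R x) / r \<le> m x" by (rule ge)
    then show "m (r *\<^sub>R x) \<le> r * m x" using r by (simp add: field_simps)
  qed
qed

text \<open>
  Zorn's lemma for the pointwise order. The infimum of a chain is finite because every sublinear
  \<open>q \<le> p\<close> satisfies \<open>q x \<ge> - q (- x) \<ge> - p (- x)\<close>, and subadditive because of any two members of
  the chain the smaller one may be used on both sides.
\<close>

lemma sublinear_minimal:
  fixes p :: "'a::real_vector \<Rightarrow> real"
  assumes p: "sublinear p"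
  obtains q where "sublinear q" "\<And>x. q x \<le> p x"
    "\<And>r. sublinear r \<Longrightarrow> (\<And>x. r x \<le> q x) \<Longrightarrow> r = q"
proof -
  define A where "A = {q. sublinear q \<and> (\<forall>x. q x \<le> p x)}"
  define P :: "('a \<Rightarrow> real) \<Rightarrow> ('a \<Rightarrow> real) \<Rightarrow> bool" where "P q r \<longleftrightarrow> (\<forall>x. r x \<le> q x)" for q r
  have "\<exists>m\<in>A. \<forall>a\<in>A. P m a \<longrightarrow> a = m"
  proof (rule predicate_Zorn)
    show "partial_order_on A (relation_of P A)"
      by (rule partial_order_on_relation_ofI)
        (auto simp: P_def fun_eq_iff intro: order_trans order_antisym)
    fix C assume C: "C \<in> Chains (relation_of P A)"
    then have CA: "C \<subseteq> A" by (rule Chains_relation_of)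
    show "\<exists>u\<in>A. \<forall>a\<in>C. P a u"
    proof (cases "C = {}")
      case True
      then show ?thesis using p by (auto simp: A_def)
    next
      case False
      define m where "m = (\<lambda>x. INF q\<in>C. q x)"
      have sub: "\<And>q. q \<in> C \<Longrightarrow> sublinear q \<and> (\<forall>x. q x \<le> p x)"
        using CA by (auto simp: A_def)
      have chain: "\<And>q r. q \<in> C \<Longrightarrow> r \<in> C \<Longrightarrow> (\<forall>x. q x \<le> r x) \<or> (\<forall>x. r x \<le> q x)"
        using C by (auto simp: Chains_def relation_of_def P_def)
      have 1: "sublinear m" "\<And>x q. q \<in> C \<Longrightarrow> m x \<le> q x"
        unfolding m_def by (rule sublinear_chain_INF[OF False sub chain]; assumption)+
      obtain q where "q \<in> C" using False by blast
      then have "\<forall>x. m x \<le> p x" using 1(2) sub by (meson order_trans)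
      then have "m \<in> A" using 1 by (auto simp: A_def)
      then show ?thesis using 1(2) by (auto simp: P_def)
    qed
  qed
  then obtain m where "m \<in> A" and min: "\<And>a. a \<in> A \<Longrightarrow> P m a \<Longrightarrow> a = m" by blast
  show thesis
  proof (rule that)
    show "sublinear m" "\<And>x. m x \<le> p x" using \<open>m \<in> A\<close> by (auto simp: A_def)
    fix r assume "sublinear r" "\<And>x. r x \<le> m x"
    then show "r = m"
      using \<open>m \<in> A\<close> by (intro min) (auto simp: A_def P_def intro: order_trans)
  qed
qed

text \<open>
  Hahn-Banach without extending functionals from subspaces: a minimal sublinear functional is odd,
  and an odd subadditive functional is additive.
\<close>

theorem sublinear_dominates_linear:
  fixes x0 :: "'a::real_vector"
  assumes p: "sublinear p"
  obtains f where "linear f" "\<And>x. f x \<le> p x" "f x0 = p x0"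
proof -
  obtain p' where p': "sublinear p'" "\<And>x. p' x \<le> p x" "p' (- x0) \<le> - p x0"
    using sublinear_tilt[OF p] by blast
  obtain q where q: "sublinear q" "\<And>x. q x \<le> p' x"
    and min: "\<And>r. sublinear r \<Longrightarrow> (\<And>x. r x \<le> q x) \<Longrightarrow> r = q"
    using sublinear_minimal[OF p'(1)] by blast
  have neg: "q (- x) = - q x" for x
  proof -
    obtain r where "sublinear r" "\<And>y. r y \<le> q y" "r (- x) \<le> - q x"
      using sublinear_tilt[OF q(1), of x] by blast
    then have "q (- x) \<le> - q x" using min by metis
    then show ?thesis using sublinear_lower[OF q(1), of x] by simp
  qed
  have "linear q"
  proof (rule linearI)
    fix x y
    show "q (x + y) = q x + q y"
      using sublinear_add[OF q(1), of x y] sublinear_add[OF q(1), of "- x" "- y"]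
        neg[of x] neg[of y] neg[of "x + y"] by simp
  next
    fix r :: real and x
    show "q (r *\<^sub>R x) = r *\<^sub>R q x"
      using sublinear_scale[OF q(1), of r x] sublinear_scale[OF q(1), of "- r" x]
        neg[of "r *\<^sub>R x"] by (cases "r \<ge> 0") auto
  qed
  moreover have "q x \<le> p x" for x using q(2) p'(2) order_trans by blast
  moreover from this have "q x0 = p x0" using q(2)[of "- x0"] p'(3) neg[of x0] by (smt (verit))
  ultimately show thesis by (rule that)
qed

lemma scaleC_zero_left [simp]: "0 *\<^sub>C x = (0::'a::complex_normed_vector)"
  using norm_scaleC[of 0 x] by simp

lemma scaleC_zero_right [simp]: "c *\<^sub>C 0 = (0::'a::complex_normed_vector)"
  using norm_scaleC[of c "0::'a"] by simp

lemma bounded_linear_cblinfun_apply: "bounded_linear (cblinfun_apply f)"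
  using cblinfun_apply[of f] by (simp add: bounded_clinear_def)

lemma cblinfun_apply_scaleC: "cblinfun_apply f (c *\<^sub>C x) = c *\<^sub>C cblinfun_apply f x"
  using cblinfun_apply[of f] by (simp add: bounded_clinear_def)

lemma norm_cblinfun: "norm (cblinfun_apply f x) \<le> norm f * norm x"
  using onorm[OF bounded_linear_cblinfun_apply] by (simp add: norm_cblinfun.rep_eq)

lemma norm_cblinfun_bound:
  assumes "0 \<le> b" "\<And>x. norm (cblinfun_apply f x) \<le> b * norm x"
  shows "norm f \<le> b"
  unfolding norm_cblinfun.rep_eq using assms by (rule onorm_bound)

lemma bounded_clinearI:
  assumes "\<And>x y. f (x + y) = f x + f y" "\<And>c x. f (c *\<^sub>C x) = c *\<^sub>C f x"
    "\<And>x. norm (f x) \<le> K * norm x"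
  shows "bounded_clinear f"
  unfolding bounded_clinear_def
proof (intro conjI allI assms(2) bounded_linear_intro[where K = K])
  show "f (r *\<^sub>R x) = r *\<^sub>R f x" for r x
    using assms(2)[of "complex_of_real r" x] by (simp add: scaleC_of_real)
qed (use assms in \<open>auto simp: mult.commute\<close>)

text \<open>
  A complex functional is determined by its real part, and rotating the argument shows that the
  bound for the real part bounds the whole functional.
\<close>

lemma cdual_of_real_part:
  fixes h :: "'a::complex_normed_vector \<Rightarrow> real"
  assumes h: "linear h" and K: "\<And>x. h x \<le> K * norm x" and "0 \<le> K"
  obtains f :: "'a cdual" where "\<And>x. Re (cblinfun_apply f x) = h x" "norm f \<le> K"
proof -
  define F where "F x = Complex (h x) (- h (\<i> *\<^sub>C x))" for x
  have neg1: "\<i> *\<^sub>C \<i> *\<^sub>C x = - x" for x :: 'a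
    using scaleC_of_real[of "-1" x] by (simp add: scaleC_scaleC)
  have add: "F (x + y) = F x + F y" for x y
    by (simp add: F_def complex_eq_iff linear_add[OF h] scaleC_add_right)
  have scR: "F (complex_of_real r *\<^sub>C x) = complex_of_real r * F x" for r x
    using scaleC_left_commute[of \<i> "complex_of_real r" x]
    by (simp add: F_def complex_eq_iff scaleC_of_real linear_scale[OF h])
  have sci: "F (\<i> *\<^sub>C x) = \<i> * F x" for x
    by (simp add: F_def complex_eq_iff neg1 linear_neg[OF h])
  have sc: "F (c *\<^sub>C x) = c *\<^sub>C F x" for c x
  proof -
    have "c *\<^sub>C x = complex_of_real (Re c) *\<^sub>C x + complex_of_real (Im c) *\<^sub>C \<i> *\<^sub>C x"
      by (subst (1) complex_eq[of c]) (simp add: scaleC_add_left scaleC_scaleC mult.commute)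
    then have "F (c *\<^sub>C x) = (Re c + Im c * \<i>) * F x"
      by (simp add: add scR sci algebra_simps)
    then show ?thesis by (simp add: scaleC_complex_def complex_eq[symmetric] mult.commute)
  qed
  have bound: "norm (F x) \<le> K * norm x" for x
  proof (cases "F x = 0")
    case True
    then show ?thesis using \<open>0 \<le> K\<close> by simp
  next
    case False
    define c where "c = cnj (F x) / cmod (F x)"
    have c: "cmod c = 1" "c * F x = cmod (F x)"
      using False
      by (auto simp: c_def norm_divide complex_norm_square[symmetric] power2_eq_square
          mult.commute[of "cnj (F x)"])
    have "cmod (F x) = Re (F (c *\<^sub>C x))" by (simp add: sc scaleC_complex_def c)
    also have "\<dots> \<le> K * norm x" using K[of "c *\<^sub>C x"] c by (simp add: F_def norm_scaleC)
    finally show ?thesis .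
  qed
  have bc: "bounded_clinear F" by (rule bounded_clinearI[OF add sc bound])
  show thesis
  proof (rule that[of "CBlinfun F"])
    show "Re (cblinfun_apply (CBlinfun F) x) = h x" for x
      using bc by (simp add: CBlinfun_inverse F_def)
    show "norm (CBlinfun F) \<le> K"
      using bc bound \<open>0 \<le> K\<close> by (intro norm_cblinfun_bound) (auto simp: CBlinfun_inverse)
  qed
qed

text \<open>
  Hahn-Banach for the norm.
\<close>

lemma norming_functional:
  fixes x :: "'a::complex_normed_vector"
  obtains f :: "'a cdual" where "norm f \<le> 1" "Re (cblinfun_apply f x) = norm x"
proof -
  have "sublinear (norm :: 'a \<Rightarrow> real)"
    by (auto simp: sublinear_def norm_triangle_ineq)
  then obtain h where h: "linear h" "\<And>y. h y \<le> norm y" "h x = norm x"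
    using sublinear_dominates_linear by blast
  have "h y \<le> 1 * norm y" for y using h(2) by simp
  then obtain f :: "'a cdual" where "\<And>x. Re (cblinfun_apply f x) = h x" "norm f \<le> 1"
    using cdual_of_real_part[OF h(1) _ zero_le_one] by blast
  then show thesis using that h(3) by metis
qed

lemma sublinear_infdist_subspace:
  fixes Y :: "'a::real_normed_vector set"
  assumes "subspace Y"
  shows "sublinear (\<lambda>x. infdist x Y)"
proof -
  have ne: "Y \<noteq> {}" using subspace_0[OF assms] by blast
  have near: "\<exists>a\<in>Y. dist x a < infdist x Y + e" if "e > 0" for x and e :: real
  proof -
    have "(INF a\<in>Y. dist x a) < infdist x Y + e"
      using that ne by (simp add: infdist_notempty)
    then show ?thesis
      using cINF_less_iff[OF ne, of "dist x"] by (auto intro: bdd_belowI2[where m = 0])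
  qed
  show ?thesis
    unfolding sublinear_def
  proof (intro conjI allI impI)
    fix x y
    show "infdist (x + y) Y \<le> infdist x Y + infdist y Y"
    proof (rule field_le_epsilon)
      fix e :: real assume "e > 0"
      then obtain a b where ab: "a \<in> Y" "b \<in> Y"
        "dist x a < infdist x Y + e/2" "dist y b < infdist y Y + e/2"
        using near[of "e/2"] by (metis half_gt_zero)
      have "infdist (x + y) Y \<le> dist (x + y) (a + b)"
        by (rule infdist_le) (rule subspace_add[OF assms ab(1,2)])
      also have "\<dots> \<le> dist x a + dist y b" by (rule dist_triangle_add)
      finally show "infdist (x + y) Y \<le> infdist x Y + infdist y Y + e" using ab by simp
    qed
  next
    fix r :: real and x :: 'a assume r: "r > 0"
    show "infdist (r *\<^sub>R x) Y \<le> r * infdist x Y"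
    proof (rule field_le_epsilon)
      fix e :: real assume "e > 0"
      then obtain a where a: "a \<in> Y" "dist x a < infdist x Y + e/r"
        using near[of "e/r"] r by (metis divide_pos_pos)
      have "infdist (r *\<^sub>R x) Y \<le> dist (r *\<^sub>R x) (r *\<^sub>R a)"
        by (rule infdist_le) (rule subspace_scale[OF assms a(1)])
      also have "\<dots> = r * dist x a" using r by (simp add: dist_norm scaleR_right_diff_distrib[symmetric])
      also have "\<dots> \<le> r * (infdist x Y + e/r)" using a r by simp
      finally show "infdist (r *\<^sub>R x) Y \<le> r * infdist x Y + e" using r by (simp add: algebra_simps)
    qed
  qed
qed

text \<open>
  Hahn-Banach for the distance from \<open>Y\<close>, which vanishes on \<open>Y\<close> and is positive at \<open>x\<close>.
\<close>

lemma separating_functional: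
  fixes x :: "'a::complex_normed_vector"
  assumes Y: "subspace Y" and x: "x \<notin> closure Y"
  shows "\<exists>f :: 'a cdual. (\<forall>y\<in>Y. Re (cblinfun_apply f y) = 0) \<and> Re (cblinfun_apply f x) > 0"
proof -
  have "0 \<in> Y" using subspace_0[OF Y] .
  obtain h where h: "linear h" "\<And>y. h y \<le> infdist y Y" "h x = infdist x Y"
    using sublinear_dominates_linear[OF sublinear_infdist_subspace[OF Y]] by blast
  have "h y \<le> 1 * norm y" for y
    using h(2)[of y] infdist_le[OF \<open>0 \<in> Y\<close>, of y] by simp
  then obtain f :: "'a cdual" where f: "\<And>x. Re (cblinfun_apply f x) = h x"
    using cdual_of_real_part[OF h(1) _ zero_le_one] by blast
  show ?thesis
  proof (intro exI[of _ f] conjI ballI)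
    fix y assume y: "y \<in> Y"
    have "h y \<le> 0" "h (- y) \<le> 0"
      using h(2)[of y] h(2)[of "- y"] y subspace_neg[OF Y y] by auto
    then show "Re (cblinfun_apply f y) = 0" by (simp add: f linear_neg[OF h(1)])
  next
    have "infdist x Y \<noteq> 0" using x \<open>0 \<in> Y\<close> in_closure_iff_infdist_zero[of Y x] by blast
    then show "Re (cblinfun_apply f x) > 0"
      using infdist_nonneg[of x Y] by (simp add: f h(3))
  qed
qed

section \<open>Schauder bases have bounded partial sums\<close>

lemma Baire_countable_cover:
  fixes A :: "nat \<Rightarrow> 'a::complete_space set"
  assumes "(\<Union>n. A n) = UNIV"
  obtains n z d where "d > 0" "ball z d \<subseteq> closure (A n)"
proof -
  have "\<exists>n. interior (closure (A n)) \<noteq> {}"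
  proof (rule ccontr)
    assume "\<not> ?thesis"
    then have "Met_TC.mtopology interior_of \<Union> (range (\<lambda>n. closure (A n))) = {}"
      by (intro Met_TC.metric_Baire_category_alt) (auto simp: complete_UNIV)
    moreover have "(\<Union>n. A n) \<subseteq> \<Union> (range (\<lambda>n. closure (A n)))"
      by (intro UN_mono closure_subset order_refl)
    ultimately show False using assms by (simp add: top.extremum_unique)
  qed
  then obtain n z where "z \<in> interior (closure (A n))" by blast
  then show thesis using that unfolding mem_interior by blast
qed

lemma summable_half_pow: "summable (\<lambda>i. c * (1/2::real) ^ i)"
  by (intro summable_mult) simp

lemma sums_half_pow: "(\<lambda>i. c * (1/2::real) ^ i) sums (2 * c)"
  using sums_mult[OF geometric_sums[of "1/2::real"], of c] by (simp add: mult.commute[of c 2])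

locale basis_expansion =
  fixes e :: "nat \<Rightarrow> 'a::complex_banach"
  assumes basis: "schauder_basis e"
begin

definition coef :: "'a \<Rightarrow> nat \<Rightarrow> complex"
  where "coef x = (THE a. (\<lambda>n. a n *\<^sub>C e n) sums x)"

definition partial :: "nat \<Rightarrow> 'a \<Rightarrow> 'a"
  where "partial n x = (\<Sum>k<n. coef x k *\<^sub>C e k)"

lemma coef_sums: "(\<lambda>n. coef x n *\<^sub>C e n) sums x"
  unfolding coef_def by (rule theI'[OF basis[unfolded schauder_basis_def, rule_format]])

lemma coef_unique: "(\<lambda>n. a n *\<^sub>C e n) sums x \<Longrightarrow> coef x = a"
  unfolding coef_def by (rule the1_equality[OF basis[unfolded schauder_basis_def, rule_format]])

lemma partial_tendsto: "(\<lambda>n. partial n x) \<longlonglongrightarrow> x"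
  using coef_sums[of x] by (simp add: sums_def partial_def)

lemma coef_add: "coef (x + y) n = coef x n + coef y n"
  using coef_unique[of "\<lambda>n. coef x n + coef y n" "x + y"]
    sums_add[OF coef_sums[of x] coef_sums[of y]] by (simp add: scaleC_add_left)

lemma coef_scaleC: "coef (c *\<^sub>C x) n = c * coef x n"
  using coef_unique[of "\<lambda>n. c * coef x n" "c *\<^sub>C x"]
    bounded_linear.sums[OF bounded_linear_scaleC coef_sums, of c x] by (simp add: scaleC_scaleC)

lemma coef_sum: "coef (\<Sum>k<n. a k *\<^sub>C e k) j = (if j < n then a j else 0)"
proof -
  have "(\<lambda>j. (if j < n then a j else 0) *\<^sub>C e j) sums
      (\<Sum>j<n. (if j < n then a j else 0) *\<^sub>C e j)"
    by (rule sums_finite) auto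
  also have "(\<Sum>j<n. (if j < n then a j else 0) *\<^sub>C e j) = (\<Sum>j<n. a j *\<^sub>C e j)"
    by (intro sum.cong) auto
  finally show ?thesis by (simp add: coef_unique)
qed

lemma basis_nonzero: "e k \<noteq> 0"
proof
  assume 0: "e k = 0"
  have "(\<lambda>n. (if n = k then 1 else 0) *\<^sub>C e n) = (\<lambda>n. 0 *\<^sub>C e n)"
    by (auto simp: 0)
  then have 1: "(\<lambda>n. (if n = k then 1 else 0) *\<^sub>C e n) sums 0" by simp
  have 2: "(\<lambda>n. 0 *\<^sub>C e n) sums 0" by simp
  have "(\<lambda>n. if n = k then 1 else 0 :: complex) = (\<lambda>n. 0)"
    using coef_unique[OF 1] coef_unique[OF 2] by simp
  then show False by (metis zero_neq_one)
qed

lemma partial_add: "partial n (x + y) = partial n x + partial n y"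
  by (simp add: partial_def coef_add scaleC_add_left sum.distrib)

lemma partial_scaleC: "partial n (c *\<^sub>C x) = c *\<^sub>C partial n x"
  unfolding partial_def coef_scaleC scaleC_scaleC[symmetric]
  by (rule linear_sum[OF bounded_linear.linear[OF bounded_linear_scaleC], symmetric])

lemma partial_scaleR: "partial n (r *\<^sub>R x) = r *\<^sub>R partial n x"
  using partial_scaleC[of n "complex_of_real r" x] by (simp add: scaleC_of_real)

lemma partial_linear: "linear (partial n)"
  by (intro linearI partial_add partial_scaleR)

lemma partial_sum:
  "partial m (\<Sum>k<n. a k *\<^sub>C e k) = (\<Sum>k<min m n. a k *\<^sub>C e k)"
proof -
  have "partial m (\<Sum>k<n. a k *\<^sub>C e k) = (\<Sum>k<m. (if k < n then a k else 0) *\<^sub>C e k)"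
    by (simp add: partial_def coef_sum)
  also have "\<dots> = (\<Sum>k<m. if k < n then a k *\<^sub>C e k else 0)"
    by (intro sum.cong) auto
  also have "\<dots> = (\<Sum>k\<in>{..<m} \<inter> {..<n}. a k *\<^sub>C e k)"
    by (simp add: sum.inter_restrict)
  also have "{..<m} \<inter> {..<n} = {..<min m n}" by auto
  finally show ?thesis .
qed

lemma partial_partial: "partial m (partial n x) = partial (min m n) x"
  using partial_sum[of m "coef x" n] by (simp add: partial_def)

lemma partial_diff_Suc: "partial (Suc k) x - partial k x = coef x k *\<^sub>C e k"
  by (simp add: partial_def)

text \<open>
  By Baire's theorem, for some constant the vectors all of whose partial sums are bounded by it are
  dense in a ball. They form a convex symmetric set, so the ball may be moved to the origin, and
  homogeneity turns this into a bound relative to the norm of \<open>y\<close>.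
\<close>

lemma approximation_with_bounded_partials:
  "\<exists>D\<ge>0. \<forall>y. \<exists>a. norm (y - a) \<le> norm y / 2 \<and> (\<forall>n. norm (partial n a) \<le> D * norm y)"
proof -
  define A :: "nat \<Rightarrow> 'a set" where "A K = {x. \<forall>n. norm (partial n x) \<le> real K}" for K
  have "x \<in> (\<Union>K. A K)" for x
  proof -
    have "Bseq (\<lambda>n. partial n x)"
      using partial_tendsto by (intro convergent_imp_Bseq convergentI)
    then obtain K where K: "\<And>n. norm (partial n x) \<le> K"
      unfolding Bseq_def by blast
    have "x \<in> A (nat \<lceil>K\<rceil>)"
      using order_trans[OF K real_nat_ceiling_ge] by (simp add: A_def)
    then show ?thesis by blast
  qed
  then have "(\<Union>K. A K) = UNIV" by blast
  then obtain K z d where d: "d > 0" "ball z d \<subseteq> closure (A K)"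
    by (rule Baire_countable_cover)
  have near0: "\<exists>a\<in>A K. norm (y - a) < \<eta>" if "norm y < d" "\<eta> > 0" for y \<eta>
  proof -
    have "z + y \<in> closure (A K)" "z - y \<in> closure (A K)"
      using d that by (auto simp: subset_iff dist_norm)
    then obtain a b where ab: "a \<in> A K" "b \<in> A K" "dist a (z + y) < \<eta>" "dist b (z - y) < \<eta>"
      using \<open>\<eta> > 0\<close> unfolding closure_approachable by blast
    let ?c = "(1/2) *\<^sub>R (a - b)"
    have "norm (partial n ?c) \<le> real K" for n
    proof -
      have n: "norm (partial n a) + norm (partial n b) \<le> real K * 2"
        using add_mono[of "norm (partial n a)" "real K" "norm (partial n b)" "real K"] ab(1,2)
        unfolding A_def mem_Collect_eq mult_2_right by blast
      have "norm (partial n ?c) = norm (partial n a - partial n b) / 2"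
        by (simp add: partial_scaleR linear_diff[OF partial_linear])
      also have "\<dots> \<le> (norm (partial n a) + norm (partial n b)) / 2"
        by (simp add: norm_triangle_ineq4)
      also have "\<dots> \<le> real K" by (simp add: n)
      finally show ?thesis .
    qed
    moreover have "norm (y - ?c) < \<eta>"
    proof -
      have "((z + y) - a) - ((z - y) - b) = (y + y) - (a - b)" by simp
      then have "y - ?c = (1/2) *\<^sub>R (((z + y) - a) - ((z - y) - b))"
        by (simp only: scaleR_right_diff_distrib scaleR_half_double)
      then have "norm (y - ?c) = norm (((z + y) - a) - ((z - y) - b)) / 2" by simp
      also have "\<dots> \<le> (norm ((z + y) - a) + norm ((z - y) - b)) / 2"
        by (intro divide_right_mono norm_triangle_ineq4) simp
      also have "\<dots> < \<eta>" using ab(3,4) by (simp add: dist_norm norm_minus_commute)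
      finally show ?thesis .
    qed
    ultimately show ?thesis by (auto simp: A_def)
  qed
  show ?thesis
  proof (intro exI[of _ "2 * real K / d"] conjI allI)
    show "2 * real K / d \<ge> 0" using d by simp
    fix y :: 'a
    show "\<exists>a. norm (y - a) \<le> norm y / 2 \<and> (\<forall>n. norm (partial n a) \<le> 2 * real K / d * norm y)"
    proof (cases "y = 0")
      case True
      then show ?thesis using linear_0[OF partial_linear] by (intro exI[of _ 0]) simp
    next
      case False
      define t where "t = 2 * norm y / d"
      have t: "t > 0" using False d by (simp add: t_def)
      have "norm ((1/t) *\<^sub>R y) = d / 2" using False d by (simp add: t_def)
      then have "norm ((1/t) *\<^sub>R y) < d" using d by simp
      then obtain a where a: "a \<in> A K" "norm ((1/t) *\<^sub>R y - a) < d / 4"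
        using near0[of "(1/t) *\<^sub>R y" "d/4"] d by auto
      have "y - t *\<^sub>R a = t *\<^sub>R ((1/t) *\<^sub>R y - a)" using t by (simp add: algebra_simps)
      then have "norm (y - t *\<^sub>R a) = t * norm ((1/t) *\<^sub>R y - a)" using t by simp
      also have "\<dots> \<le> t * (d / 4)" using a t by (intro mult_left_mono) auto
      also have "\<dots> = norm y / 2" using d by (simp add: t_def)
      finally have 1: "norm (y - t *\<^sub>R a) \<le> norm y / 2" .
      have 2: "norm (partial n (t *\<^sub>R a)) \<le> 2 * real K / d * norm y" for n
      proof -
        have "norm (partial n (t *\<^sub>R a)) = t * norm (partial n a)"
          using t by (simp add: partial_scaleR)
        also have "\<dots> \<le> t * real K" using a(1) t by (simp add: A_def)
        finally show ?thesis by (simp add: t_def field_simps)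
      qed
      show ?thesis using 1 2 by blast
    qed
  qed
qed

text \<open>
  The open mapping argument: iterating the approximation writes \<open>x\<close> as a series whose terms have
  geometrically decreasing norms and partial sums. The sum of the expansions of the terms converges
  to \<open>x\<close>, so by uniqueness it is the expansion of \<open>x\<close>, and its partial sums are bounded by the
  geometric series.
\<close>

theorem partial_uniformly_bounded:
  "\<exists>C\<ge>0. \<forall>n x. norm (partial n x) \<le> C * norm x"
proof -
  obtain D where "D \<ge> 0" and
    D: "\<forall>y. \<exists>a. norm (y - a) \<le> norm y / 2 \<and> (\<forall>n. norm (partial n a) \<le> D * norm y)"
    using approximation_with_bounded_partials by blast
  from choice[OF D]
  obtain \<alpha> where \<alpha>: "\<And>y. norm (y - \<alpha> y) \<le> norm y / 2"
    "\<And>y n. norm (partial n (\<alpha> y)) \<le> D * norm y"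
    by blast
  have "norm (partial n x) \<le> 2 * D * norm x" for n x
  proof -
    \<comment> \<open>The remainders of the iterated approximation.\<close>
    define r where "r i = ((\<lambda>y. y - \<alpha> y) ^^ i) x" for i
    define E where "E = D * norm x"
    have r0: "r 0 = x" and rS: "r (Suc i) = r i - \<alpha> (r i)" for i by (simp_all add: r_def)
    have r_le: "norm (r i) \<le> norm x * (1/2) ^ i" for i
    proof (induction i)
      case (Suc i)
      then show ?case using \<alpha>(1)[of "r i"] by (simp add: rS)
    qed (simp add: r0)
    have P_le: "norm (partial m (\<alpha> (r i))) \<le> E * (1/2) ^ i" for m i
      using \<alpha>(2)[of m "r i"] mult_left_mono[OF r_le[of i] \<open>D \<ge> 0\<close>] by (simp add: E_def algebra_simps)
    define b where "b k = (\<Sum>i. coef (\<alpha> (r i)) k)" for k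
    have b_sums: "(\<lambda>i. coef (\<alpha> (r i)) k) sums b k" for k
    proof -
      have c_le: "norm (coef (\<alpha> (r i)) k) \<le> (2 * E / norm (e k)) * (1/2) ^ i" for i
      proof -
        have "norm (coef (\<alpha> (r i)) k) * norm (e k)
            = norm (partial (Suc k) (\<alpha> (r i)) - partial k (\<alpha> (r i)))"
          by (simp add: partial_diff_Suc norm_scaleC)
        also have "\<dots> \<le> 2 * E * (1/2) ^ i"
          using norm_triangle_ineq4[of "partial (Suc k) (\<alpha> (r i))" "partial k (\<alpha> (r i))"]
            P_le[of "Suc k" i] P_le[of k i] by linarith
        finally show ?thesis using basis_nonzero[of k] by (simp add: field_simps)
      qed
      have "summable (\<lambda>i. coef (\<alpha> (r i)) k)"
        by (rule summable_comparison_test'[OF summable_half_pow, of 0]) (rule c_le)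
      then show ?thesis by (simp add: b_def summable_sums)
    qed
    \<comment> \<open>The candidate for the partial sums of \<open>x\<close>.\<close>
    define Q where "Q m = (\<Sum>k<m. b k *\<^sub>C e k)" for m
    have bl: "bounded_linear (\<lambda>c. c *\<^sub>C e k)" for k
    proof (rule bounded_linear_intro[where K = "norm (e k)"])
      show "(r *\<^sub>R c) *\<^sub>C e k = r *\<^sub>R (c *\<^sub>C e k)" for r :: real and c
        by (simp add: scaleC_of_real[symmetric] scaleC_scaleC scaleC_complex_def)
    qed (auto simp: scaleC_add_left norm_scaleC)
    have Q_sums: "(\<lambda>i. partial m (\<alpha> (r i))) sums Q m" for m
      unfolding partial_def Q_def by (rule sums_sum) (rule bounded_linear.sums[OF bl b_sums])
    have P_sum: "(\<Sum>i<j. partial m (\<alpha> (r i))) = partial m (x - r j)" for j m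
    proof -
      have "(\<Sum>i<j. \<alpha> (r i)) = x - r j" by (induction j) (simp_all add: r0 rS)
      then show ?thesis by (simp only: linear_sum[OF partial_linear, symmetric])
    qed
    have Q_near: "norm (Q m - partial m (x - r j)) \<le> 2 * E * (1/2) ^ j" for m j
    proof (rule norm_sums_le)
      show "(\<lambda>i. partial m (\<alpha> (r (i + j)))) sums (Q m - partial m (x - r j))"
        using sums_split_initial_segment[OF Q_sums, of m j] by (simp add: P_sum)
      show "(\<lambda>i. (E * (1/2) ^ j) * (1/2) ^ i) sums (2 * E * (1/2) ^ j)"
        using sums_half_pow[of "E * (1/2) ^ j"] by (simp only: mult.assoc)
      show "norm (partial m (\<alpha> (r (i + j)))) \<le> (E * (1/2) ^ j) * (1/2) ^ i" for i
        using P_le[of m "i + j"] by (simp add: power_add algebra_simps)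
    qed
    \<comment> \<open>Up to a geometric tail, \<open>Q m\<close> is a partial sum of a finite sum of terms.\<close>
    have "Q \<longlonglongrightarrow> x"
    proof (rule LIMSEQ_I)
      fix \<eta> :: real assume "\<eta> > 0"
      have "(\<lambda>j. (2 * E + norm x) * (1/2) ^ j) \<longlonglongrightarrow> 0"
        using summable_LIMSEQ_zero[OF summable_half_pow] .
      then have "\<forall>\<^sub>F j in sequentially. (2 * E + norm x) * (1/2) ^ j < \<eta> / 2"
        by (rule order_tendstoD) (use \<open>\<eta> > 0\<close> in simp)
      then obtain j where j: "(2 * E + norm x) * (1/2) ^ j < \<eta> / 2"
        by (auto simp: eventually_sequentially)
      obtain M where M: "\<And>m. m \<ge> M \<Longrightarrow> norm (partial m (x - r j) - (x - r j)) < \<eta> / 2"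
        using LIMSEQ_D[OF partial_tendsto half_gt_zero[OF \<open>\<eta> > 0\<close>]] by blast
      have "norm (Q m - x) < \<eta>" if "m \<ge> M" for m
      proof -
        let ?a = "Q m - partial m (x - r j)" and ?b = "partial m (x - r j) - (x - r j)"
        have "Q m - x = ?a + ?b - r j" by simp
        then have "norm (Q m - x) = norm (?a + ?b - r j)" by (rule arg_cong)
        then have "norm (Q m - x) \<le> norm ?a + norm ?b + norm (r j)"
          using norm_triangle_ineq4[of "?a + ?b" "r j"] norm_triangle_ineq[of ?a ?b] by linarith
        also have "\<dots> < \<eta>"
          using Q_near[of m j] M[OF that] r_le[of j] j unfolding distrib_right by linarith
        finally show ?thesis .
      qed
      then show "\<exists>M. \<forall>m\<ge>M. norm (Q m - x) < \<eta>" by blast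
    qed
    then have "coef x = b" by (intro coef_unique) (simp add: sums_def Q_def[abs_def])
    then have "partial n x = Q n" by (simp add: partial_def Q_def)
    then show ?thesis
      using Q_near[of n 0] linear_0[OF partial_linear] by (simp add: r0 E_def)
  qed
  then show ?thesis using \<open>D \<ge> 0\<close> by (intro exI[of _ "2 * D"]) auto
qed

lemma bounded_clinear_partial: "bounded_clinear (partial n)"
proof -
  obtain C where "\<And>n x. norm (partial n x) \<le> C * norm x"
    using partial_uniformly_bounded by blast
  then show ?thesis by (intro bounded_clinearI partial_add partial_scaleC)
qed

lemma bounded_clinear_coef: "bounded_clinear (\<lambda>x. coef x k)"
proof -
  obtain C where C: "\<And>n x. norm (partial n x) \<le> C * norm x"
    using partial_uniformly_bounded by blast
  show ?thesis
  proof (rule bounded_clinearI)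
    fix x
    have "norm (coef x k) * norm (e k) = norm (partial (Suc k) x - partial k x)"
      by (simp add: partial_diff_Suc norm_scaleC)
    also have "\<dots> \<le> 2 * C * norm x"
      using norm_triangle_ineq4[of "partial (Suc k) x" "partial k x"] C[of "Suc k" x] C[of k x]
      by simp
    finally show "norm (coef x k) \<le> (2 * C / norm (e k)) * norm x"
      using basis_nonzero[of k] by (simp add: field_simps)
  qed (auto simp: coef_add coef_scaleC scaleC_complex_def)
qed

end

section \<open>Operators with escaping orbits\<close>

lemma relatively_compact_subset_compact:
  fixes K :: "'a::t2_space set"
  assumes "compact K" "S \<subseteq> K"
  shows "relatively_compact S"
proof -
  have "closure S \<subseteq> K" using assms by (intro closure_minimal compact_imp_closed)
  then show ?thesis
    unfolding relatively_compact_def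
    using compact_Int_closed[OF assms(1) closed_closure, of S] by (simp add: Int_absorb1)
qed

lemma relatively_compact_convergent:
  fixes s :: "nat \<Rightarrow> 'a::metric_space"
  assumes "s \<longlonglongrightarrow> l"
  shows "relatively_compact (range s)"
proof (rule relatively_compact_subset_compact)
  show "compact (insert l (range s))"
    using compactin_sequence_with_limit[of euclidean s l] assms by auto
qed auto

lemma power_boundedI:
  assumes "0 \<le> K" "\<And>n x. norm ((cblinfun_apply T ^^ n) x) \<le> K * norm x"
  shows "power_bounded T"
  unfolding power_bounded_def using assms by (intro bdd_aboveI[where M = K]) (auto intro: onorm_bound)

lemma half_pow_Suc_sum: "(\<Sum>n<N. (1/2::real) ^ Suc n) = 1 - (1/2) ^ N"
  by (induction N) auto

text \<open>
  The vectors \<open>u n\<close> behave like the sections \<open>S n s\<close> of an ideal vector \<open>s\<close> at which \<open>g\<close> takes the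
  value \<open>1\<close>; divergence of \<open>u\<close> says that \<open>s\<close> is missing from the space.
\<close>

locale escaping_system =
  fixes S :: "nat \<Rightarrow> 'a::complex_banach \<Rightarrow> 'a" and u :: "nat \<Rightarrow> 'a" and g :: "'a \<Rightarrow> complex"
    and C B :: real
  assumes S_clinear: "bounded_clinear (S n)"
    and S_bound: "norm (S n x) \<le> C * norm x"
    and S_S: "S m (S n x) = S (min m n) x"
    and S_tendsto: "(\<lambda>n. S n x) \<longlonglongrightarrow> x"
    and u_bound: "norm (u n) \<le> B"
    and S_u: "m \<le> n \<Longrightarrow> S m (u n) = u m"
    and u_divergent: "\<not> convergent u"
    and g_clinear: "bounded_clinear g"
    and g_S: "g (S n x) = g x"
    and g_u: "g (u n) = 1"
begin

lemma S_linear: "linear (S n)" and S_blinear: "bounded_linear (S n)"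
  using S_clinear[of n] by (auto simp: bounded_clinear_def bounded_linear.linear)

lemma S_diff: "S n (x - y) = S n x - S n y"
  by (rule linear_diff[OF S_linear])

lemma C_nonneg: "0 \<le> C"
proof -
  obtain m where "u m \<noteq> 0" using u_divergent by (metis convergent_const ext)
  moreover have "0 \<le> C * norm (u m)"
    using S_bound[of 0 "u m"] norm_ge_zero order_trans by blast
  ultimately show ?thesis by (simp add: zero_le_mult_iff)
qed

lemma B_nonneg: "0 \<le> B"
  using u_bound[of 0] norm_ge_zero order_trans by blast

text \<open>
  A convex combination of the projections \<open>1 - S n\<close>. They multiply by
  \<open>(1 - S m) (1 - S n) = 1 - S (max m n)\<close>, so all powers of \<open>L\<close> are such combinations too.
\<close>

definition L :: "'a \<Rightarrow> 'a"
  where "L x = (\<Sum>n. (1/2) ^ Suc n *\<^sub>R (x - S n x))"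

text \<open>
  This stands for \<open>s - L s\<close>.
\<close>

definition v :: 'a
  where "v = (\<Sum>n. (1/2) ^ Suc n *\<^sub>R u n)"

lemma half_sums: "(\<lambda>n. (1/2) ^ Suc n *\<^sub>R y) sums (y :: 'b::real_normed_vector)"
  using sums_scaleR_left[OF power_half_series, of y] by simp

lemma half_scaled_sums: "(\<lambda>n. (1/2) ^ Suc n * r) sums (r :: real)"
  using sums_mult2[OF power_half_series, of r] by simp

lemma half_weighted_sums:
  fixes y :: "nat \<Rightarrow> 'a"
  assumes "\<And>n. norm (y n) \<le> r"
  shows "(\<lambda>n. (1/2) ^ Suc n *\<^sub>R y n) sums (\<Sum>n. (1/2) ^ Suc n *\<^sub>R y n)"
  by (rule summable_sums, rule summable_comparison_test'[OF sums_summable[OF half_scaled_sums], of 0])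
    (use assms in \<open>simp add: mult_left_mono\<close>)

lemma diff_S_bound: "norm (x - S n x) \<le> (1 + C) * norm x"
  using norm_triangle_ineq4[of x "S n x"] S_bound[of n x] by (simp add: algebra_simps)

lemma L_sums: "(\<lambda>n. (1/2) ^ Suc n *\<^sub>R (x - S n x)) sums L x"
  unfolding L_def by (rule half_weighted_sums[OF diff_S_bound])

lemma v_sums: "(\<lambda>n. (1/2) ^ Suc n *\<^sub>R u n) sums v"
  unfolding v_def by (rule half_weighted_sums[OF u_bound])

lemma L_add: "L (x + y) = L x + L y"
proof (rule sums_unique2[OF L_sums])
  show "(\<lambda>n. (1/2) ^ Suc n *\<^sub>R (x + y - S n (x + y))) sums (L x + L y)"
    using sums_add[OF L_sums[of x] L_sums[of y]]
    by (simp add: linear_add[OF S_linear] algebra_simps)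
qed

lemma L_scaleC: "L (c *\<^sub>C x) = c *\<^sub>C L x"
proof (rule sums_unique2[OF L_sums])
  have "(1/2) ^ Suc n *\<^sub>R (c *\<^sub>C x - S n (c *\<^sub>C x)) = c *\<^sub>C ((1/2) ^ Suc n *\<^sub>R (x - S n x))" for n
    using S_clinear[of n]
    by (simp add: bounded_clinear_def scaleC_diff_right scaleC_of_real[symmetric] scaleC_left_commute
        del: power_Suc)
  then show "(\<lambda>n. (1/2) ^ Suc n *\<^sub>R (c *\<^sub>C x - S n (c *\<^sub>C x))) sums (c *\<^sub>C L x)"
    using bounded_linear.sums[OF bounded_linear_scaleC L_sums, of c x] by simp
qed

lemma L_linear: "linear L"
  using L_scaleC[of "complex_of_real _"] by (intro linearI L_add) (simp add: scaleC_of_real)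

lemma S_L: "S m (L x) = L (S m x)"
proof (rule sums_unique2[OF bounded_linear.sums[OF S_blinear L_sums]])
  have "S m ((1/2) ^ Suc n *\<^sub>R (x - S n x)) = (1/2) ^ Suc n *\<^sub>R (S m x - S n (S m x))" for n
    by (simp add: linear_scale[OF S_linear] S_diff S_S min.commute del: power_Suc)
  then show "(\<lambda>n. S m ((1/2) ^ Suc n *\<^sub>R (x - S n x))) sums L (S m x)"
    using L_sums[of "S m x"] by simp
qed

text \<open>
  The least such \<open>r\<close> is an equivalent norm of \<open>x\<close> in which every projection \<open>1 - S m\<close>, and hence
  their average \<open>L\<close>, is a contraction.
\<close>

definition defects_le :: "'a \<Rightarrow> real \<Rightarrow> bool"
  where "defects_le x r \<longleftrightarrow> norm x \<le> r \<and> (\<forall>n. norm (x - S n x) \<le> r)"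

lemma diff_S_diff_S: "(x - S m x) - S n (x - S m x) = x - S (max m n) x"
  by (cases "m \<le> n") (auto simp: S_diff S_S min_def max_def)

lemma norm_L:
  assumes "\<And>n. norm (x - S n x) \<le> r"
  shows "norm (L x) \<le> r"
  by (rule norm_sums_le[OF L_sums half_scaled_sums])
    (use assms in \<open>simp add: mult_left_mono\<close>)

lemma norm_L_strict:
  assumes "\<And>n. norm (x - S n x) \<le> r" "\<And>n. n \<ge> N \<Longrightarrow> x - S n x = 0"
  shows "norm (L x) \<le> (1 - (1/2) ^ N) * r"
proof -
  have "(\<lambda>n. (1/2) ^ Suc n *\<^sub>R (x - S n x)) sums (\<Sum>n<N. (1/2) ^ Suc n *\<^sub>R (x - S n x))"
    by (rule sums_finite) (use assms(2) in auto)
  then have "L x = (\<Sum>n<N. (1/2) ^ Suc n *\<^sub>R (x - S n x))"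
    by (rule sums_unique2[OF L_sums])
  also have "norm \<dots> \<le> (\<Sum>n<N. (1/2) ^ Suc n * r)"
    by (rule sum_norm_le) (use assms(1) in \<open>simp add: mult_left_mono\<close>)
  also have "\<dots> = (1 - (1/2) ^ N) * r"
    by (simp add: sum_distrib_right[symmetric] half_pow_Suc_sum del: power_Suc)
  finally show ?thesis .
qed

lemma L_diff_S: "L x - S m (L x) = L (x - S m x)"
  by (simp add: S_L linear_diff[OF L_linear])

lemma defects_le_L: "defects_le x r \<Longrightarrow> defects_le (L x) r"
  unfolding defects_le_def L_diff_S by (intro conjI allI norm_L) (simp_all only: diff_S_diff_S)

text \<open>
  On the range of \<open>S N\<close> the projections \<open>1 - S n\<close> with \<open>n \<ge> N\<close> vanish, and only the weights of the
  others, with sum \<open>1 - (1/2) ^ N\<close>, contribute.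
\<close>

lemma defects_le_L_fixed:
  assumes "defects_le x r" "S N x = x"
  shows "defects_le (L x) ((1 - (1/2) ^ N) * r)"
proof -
  have z: "x - S n x = 0" if "n \<ge> N" for n
    using S_S[of n N x] assms(2) that by (simp add: min_def split: if_splits)
  show ?thesis
    unfolding defects_le_def L_diff_S
  proof (intro conjI allI norm_L_strict)
    fix m n
    show "norm (x - S n x) \<le> r" using assms by (simp add: defects_le_def)
    show "n \<ge> N \<Longrightarrow> x - S n x = 0" by (rule z)
    show "norm (x - S m x - S n (x - S m x)) \<le> r" using assms unfolding diff_S_diff_S by (simp add: defects_le_def)
    show "n \<ge> N \<Longrightarrow> x - S m x - S n (x - S m x) = 0" unfolding diff_S_diff_S by (rule z) simp
  qed
qed

lemma defects_le_start: "defects_le x ((1 + C) * norm x)"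
  using diff_S_bound C_nonneg by (auto simp: defects_le_def algebra_simps)

lemma L_pow_bound: "norm ((L ^^ k) x) \<le> (1 + C) * norm x"
proof -
  have "defects_le ((L ^^ k) x) ((1 + C) * norm x)"
    by (induction k) (auto intro: defects_le_L defects_le_start)
  then show ?thesis by (simp add: defects_le_def)
qed

lemma L_pow_linear: "linear (L ^^ k)"
proof (induction k)
  case 0
  show ?case by (rule linearI) auto
next
  case (Suc k)
  show ?case using linear_compose[OF Suc.IH L_linear] by (simp only: funpow.simps)
qed

text \<open>
  The powers decay geometrically on the dense union of the ranges of the \<open>S N\<close>, and they are
  uniformly bounded.
\<close>

lemma L_pow_tendsto_0: "(\<lambda>k. (L ^^ k) x) \<longlonglongrightarrow> 0"
proof -
  have on_range: "(\<lambda>k. (L ^^ k) (S N x)) \<longlonglongrightarrow> 0" for N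
  proof -
    define z where "z = S N x"
    define q :: real where "q = 1 - (1/2) ^ N"
    have q: "0 \<le> q" "q < 1" by (auto simp: q_def power_le_one)
    have "defects_le ((L ^^ k) z) (q ^ k * ((1 + C) * norm z)) \<and> S N ((L ^^ k) z) = (L ^^ k) z" for k
    proof (induction k)
      case 0
      show ?case using defects_le_start by (simp add: z_def S_S)
    next
      case (Suc k)
      then show ?case
        using defects_le_L_fixed[of "(L ^^ k) z" _ N] by (auto simp: S_L q_def mult.assoc)
    qed
    then have le: "norm ((L ^^ k) z) \<le> q ^ k * ((1 + C) * norm z)" for k by (simp add: defects_le_def)
    have "(\<lambda>k. (L ^^ k) z) \<longlonglongrightarrow> 0"
    proof (rule Lim_null_comparison)
      show "\<forall>\<^sub>F k in sequentially. norm ((L ^^ k) z) \<le> q ^ k * ((1 + C) * norm z)"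
        using le by simp
      show "(\<lambda>k. q ^ k * ((1 + C) * norm z)) \<longlonglongrightarrow> 0"
        using q by (intro tendsto_mult_left_zero LIMSEQ_realpow_zero) auto
    qed
    then show ?thesis by (simp add: z_def)
  qed
  show ?thesis
  proof (rule LIMSEQ_I)
    fix \<eta> :: real assume "\<eta> > 0"
    have "(\<lambda>N. (1 + C) * norm (x - S N x)) \<longlonglongrightarrow> (1 + C) * norm (x - x)"
      by (intro tendsto_intros S_tendsto)
    then have "\<forall>\<^sub>F N in sequentially. (1 + C) * norm (x - S N x) < \<eta> / 2"
      by (rule order_tendstoD) (use \<open>\<eta> > 0\<close> in simp)
    then obtain N where N: "(1 + C) * norm (x - S N x) < \<eta> / 2"
      by (auto simp: eventually_sequentially)
    obtain K where K: "\<And>k. k \<ge> K \<Longrightarrow> norm ((L ^^ k) (S N x)) < \<eta> / 2"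
      using LIMSEQ_D[OF on_range[of N], of "\<eta> / 2"] \<open>\<eta> > 0\<close> by (auto simp del: funpow.simps)
    have "norm ((L ^^ k) x - 0) < \<eta>" if "k \<ge> K" for k
    proof -
      have "(L ^^ k) x = (L ^^ k) (x - S N x) + (L ^^ k) (S N x)"
        by (simp add: linear_diff[OF L_pow_linear])
      then show ?thesis
        using norm_triangle_ineq[of "(L ^^ k) (x - S N x)" "(L ^^ k) (S N x)"]
          L_pow_bound[of k "x - S N x"] K[OF that] N by simp
    qed
    then show "\<exists>K. \<forall>k\<ge>K. norm ((L ^^ k) x - 0) < \<eta>" by blast
  qed
qed

text \<open>
  The sections of \<open>v = s - L s\<close>.
\<close>

lemma S_v: "S m v = u m - L (u m)"
proof (rule sums_unique2[OF bounded_linear.sums[OF S_blinear v_sums]])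
  have "S m (u n) = S n (u m)" for n
    using S_u[of "min m n" "max m n"] S_u[of n m] S_u[of m n] S_u[of n n] S_u[of m m]
      S_S[of m n "u m"] S_S[of n m "u n"]
    by (cases "m \<le> n") (auto simp: min_def split: if_splits)
  then have "S m ((1/2) ^ Suc n *\<^sub>R u n) = (1/2) ^ Suc n *\<^sub>R u m - (1/2) ^ Suc n *\<^sub>R (u m - S n (u m))" for n
    by (simp add: linear_scale[OF S_linear] algebra_simps del: power_Suc)
  then show "(\<lambda>n. S m ((1/2) ^ Suc n *\<^sub>R u n)) sums (u m - L (u m))"
    using sums_diff[OF half_sums L_sums] by simp
qed

lemma g_blinear: "bounded_linear g" and g_linear: "linear g"
  using g_clinear by (auto simp: bounded_clinear_def bounded_linear.linear)

lemma g_L: "g (L x) = 0"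
proof (rule sums_unique2[OF bounded_linear.sums[OF g_blinear L_sums]])
  show "(\<lambda>n. g ((1/2) ^ Suc n *\<^sub>R (x - S n x))) sums 0"
    by (simp add: linear_scale[OF g_linear] linear_diff[OF g_linear] g_S)
qed

lemma g_v: "g v = 1"
proof (rule sums_unique2[OF bounded_linear.sums[OF g_blinear v_sums]])
  show "(\<lambda>n. g ((1/2) ^ Suc n *\<^sub>R u n)) sums 1"
    using half_sums[of "1::complex"] by (simp add: linear_scale[OF g_linear] g_u del: power_Suc)
qed

definition T :: "'a \<Rightarrow> 'a"
  where "T x = L x + g x *\<^sub>C v"

text \<open>
  The orbit of \<open>0\<close> under the affine map with linear part \<open>L\<close> and fixed point \<open>s\<close>; it stands for
  \<open>s - L ^^ k s\<close>.
\<close>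

primrec w :: "nat \<Rightarrow> 'a"
  where "w 0 = 0" | "w (Suc k) = L (w k) + v"

lemma w_diff: "w (Suc k) - w k = (L ^^ k) v"
proof (induction k)
  case (Suc k)
  have "w (Suc (Suc k)) - w (Suc k) = L (w (Suc k) - w k)"
    by (simp add: linear_diff[OF L_linear])
  then show ?case using Suc by simp
qed (simp add: linear_0[OF L_linear])

lemma S_w: "S m (w k) = u m - (L ^^ k) (u m)"
proof (induction k)
  case (Suc k)
  then show ?case
    by (simp add: linear_add[OF S_linear] S_L S_v linear_diff[OF L_linear])
qed (simp add: linear_0[OF S_linear])

text \<open>
  The sections of \<open>w k\<close> are bounded independently of \<open>k\<close>, and they converge to \<open>w k\<close>.
\<close>

lemma w_bound: "norm (w k) \<le> (2 + C) * B"
proof (rule tendsto_upperbound)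
  show "(\<lambda>m. norm (S m (w k))) \<longlonglongrightarrow> norm (w k)"
    by (intro tendsto_intros S_tendsto)
  have "norm (S m (w k)) \<le> (2 + C) * B" for m
  proof -
    have "norm (S m (w k)) \<le> norm (u m) + (1 + C) * norm (u m)"
      unfolding S_w using norm_triangle_ineq4[of "u m" "(L ^^ k) (u m)"] L_pow_bound[of k "u m"]
      by simp
    also have "\<dots> = (2 + C) * norm (u m)" by (simp add: algebra_simps)
    also have "\<dots> \<le> (2 + C) * B"
      using u_bound C_nonneg by (simp add: mult_left_mono)
    finally show ?thesis .
  qed
  then show "\<forall>\<^sub>F m in sequentially. norm (S m (w k)) \<le> (2 + C) * B" by simp
qed simp

text \<open>
  \<open>g\<close> is invariant under \<open>T\<close>, so \<open>T\<close> acts on each hyperplane \<open>g = c\<close> as an affine map.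
\<close>

lemma T_pow: "(T ^^ k) x = (L ^^ k) x + g x *\<^sub>C w k"
proof -
  have g_T: "g (T y) = g y" for y
    using g_clinear by (simp add: T_def linear_add[OF g_linear] g_L bounded_clinear_def g_v scaleC_complex_def)
  have g_T_pow: "g ((T ^^ k) x) = g x" for k by (induction k) (auto simp: g_T)
  show ?thesis
  proof (induction k)
    case 0
    then show ?case by simp
  next
    case (Suc k)
    have "(T ^^ Suc k) x = L ((T ^^ k) x) + g x *\<^sub>C v"
      using g_T_pow[of k] by (simp add: T_def)
    then show ?case by (simp add: Suc L_add L_scaleC scaleC_add_right add.assoc)
  qed
qed

lemma T_pow_bound: "norm ((T ^^ k) x) \<le> (1 + C + onorm g * ((2 + C) * B)) * norm x"
proof -
  have "norm ((T ^^ k) x) \<le> norm ((L ^^ k) x) + norm (g x) * norm (w k)"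
    unfolding T_pow using norm_triangle_ineq[of "(L ^^ k) x"] by (metis norm_scaleC)
  also have "\<dots> \<le> (1 + C) * norm x + (onorm g * norm x) * ((2 + C) * B)"
    by (intro add_mono mult_mono L_pow_bound onorm[OF g_blinear] w_bound)
      (auto intro!: mult_nonneg_nonneg onorm_pos_le g_blinear)
  finally show ?thesis by (simp add: algebra_simps)
qed

text \<open>
  The orbit of \<open>v\<close> under \<open>T\<close> is the sequence \<open>w (Suc n)\<close>. Its sections \<open>S m (w n)\<close> tend to \<open>u m\<close>, so
  a cluster point would be a vector with the sections \<open>u m\<close>, contradicting the divergence of \<open>u\<close>.
\<close>

theorem operator_with_escaping_orbit:
  "\<exists>A :: 'a \<Rightarrow>\<^sub>C\<^sub>L 'a. power_bounded A \<and>
     (\<forall>x. relatively_compact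
        (range (\<lambda>n. (cblinfun_apply A ^^ (n + 1)) x - (cblinfun_apply A ^^ n) x))) \<and>
     \<not> almost_periodic A"
proof -
  let ?K = "1 + C + onorm g * ((2 + C) * B)"
  have K: "?K \<ge> 0" using C_nonneg B_nonneg onorm_pos_le[OF g_blinear] by simp
  have "bounded_clinear T"
  proof (rule bounded_clinearI)
    show "T (x + y) = T x + T y" for x y
      by (simp add: T_def L_add linear_add[OF g_linear] scaleC_add_left)
    show "T (c *\<^sub>C x) = c *\<^sub>C T x" for c x
      using g_clinear
      by (simp add: T_def L_scaleC bounded_clinear_def scaleC_add_right scaleC_scaleC scaleC_complex_def)
    show "norm (T x) \<le> ?K * norm x" for x
      using T_pow_bound[of 1 x] by simp
  qed
  then have A: "cblinfun_apply (CBlinfun T) = T" by (simp add: CBlinfun_inverse)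
  have "power_bounded (CBlinfun T)"
    using K T_pow_bound by (intro power_boundedI[where K = ?K]) (simp_all add: A)
  moreover have "relatively_compact (range (\<lambda>n. (T ^^ (n + 1)) x - (T ^^ n) x))" for x
  proof (rule relatively_compact_convergent)
    have "(T ^^ (n + 1)) x - (T ^^ n) x = (L ^^ Suc n) x - (L ^^ n) x + g x *\<^sub>C (L ^^ n) v" for n
      by (simp add: T_pow w_diff[symmetric] scaleC_diff_right del: w.simps funpow.simps)
    moreover have "(\<lambda>n. (L ^^ Suc n) x - (L ^^ n) x + g x *\<^sub>C (L ^^ n) v) \<longlonglongrightarrow> 0 - 0 + g x *\<^sub>C 0"
      by (intro tendsto_intros bounded_linear.tendsto[OF bounded_linear_scaleC]
          L_pow_tendsto_0 LIMSEQ_Suc[OF L_pow_tendsto_0])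
    ultimately show "(\<lambda>n. (T ^^ (n + 1)) x - (T ^^ n) x) \<longlonglongrightarrow> 0 - 0 + g x *\<^sub>C 0" by presburger
  qed
  moreover have "\<not> relatively_compact (range (\<lambda>n. (T ^^ n) v))"
  proof
    assume "relatively_compact (range (\<lambda>n. (T ^^ n) v))"
    moreover have "(T ^^ n) v = w (Suc n)" for n
      by (simp only: T_pow g_v scaleC_one w_diff[symmetric] diff_add_cancel)
    ultimately have comp: "compact (closure (range (\<lambda>n. w (Suc n))))"
      by (simp add: relatively_compact_def)
    have "\<forall>n. w (Suc n) \<in> closure (range (\<lambda>n. w (Suc n)))"
      by (intro allI closure_subset[THEN subsetD] rangeI)
    from mp[OF spec[OF comp[unfolded compact_def]] this]
    obtain l r where r: "strict_mono r" and l: "((\<lambda>n. w (Suc n)) \<circ> r) \<longlonglongrightarrow> l"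
      by blast
    have "S m l = u m" for m
    proof (rule LIMSEQ_unique)
      show "(\<lambda>n. S m (w (Suc (r n)))) \<longlonglongrightarrow> S m l"
        using bounded_linear.tendsto[OF S_blinear l] by (simp add: o_def)
      have "(\<lambda>n. u m - (L ^^ Suc n) (u m)) \<longlonglongrightarrow> u m - 0"
        by (intro tendsto_intros LIMSEQ_Suc[OF L_pow_tendsto_0])
      from LIMSEQ_subseq_LIMSEQ[OF this r]
      show "(\<lambda>n. S m (w (Suc (r n)))) \<longlonglongrightarrow> u m"
        unfolding S_w by (simp only: o_def diff_0_right)
    qed
    then have "u \<longlonglongrightarrow> l" using S_tendsto[of l] by simp
    then show False using u_divergent by (auto simp: convergent_def)
  qed
  ultimately show ?thesis
    unfolding almost_periodic_def by (intro exI[of _ "CBlinfun T"]) (auto simp: A)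
qed

end

section \<open>Bases of nonreflexive spaces\<close>

definition escaping_operator :: "('a::complex_normed_vector \<Rightarrow>\<^sub>C\<^sub>L 'a) \<Rightarrow> bool"
  where "escaping_operator A \<longleftrightarrow> power_bounded A \<and>
    (\<forall>x. relatively_compact
      (range (\<lambda>n. (cblinfun_apply A ^^ (n + 1)) x - (cblinfun_apply A ^^ n) x))) \<and>
    \<not> almost_periodic A"

context basis_expansion
begin

text \<open>
  The ideal vector is the divergent series itself. Sections shorter than the index \<open>k\<^sub>0\<close> of a nonzero
  coefficient are skipped, so that the coordinate \<open>k\<^sub>0\<close> is the same for all sections.
\<close>

lemma escaping_operator_if_not_boundedly_complete:
  assumes bound: "\<And>n. norm (\<Sum>k<n. a k *\<^sub>C e k) \<le> B"
    and div: "\<not> convergent (\<lambda>n. \<Sum>k<n. a k *\<^sub>C e k)"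
  shows "\<exists>A :: 'a \<Rightarrow>\<^sub>C\<^sub>L 'a. escaping_operator A"
proof -
  have "\<exists>k0. a k0 \<noteq> 0"
  proof (rule ccontr)
    assume "\<not> ?thesis"
    then show False using div by (simp add: convergent_const)
  qed
  then obtain k0 where k0: "a k0 \<noteq> 0" by blast
  obtain C where C: "\<And>n x. norm (partial n x) \<le> C * norm x"
    using partial_uniformly_bounded by blast
  define u where "u n = (\<Sum>k<n + Suc k0. a k *\<^sub>C e k)" for n
  define g where "g x = coef x k0 / a k0" for x
  interpret escaping_system "\<lambda>n. partial (n + Suc k0)" u g C B
  proof
    fix m n x
    show "bounded_clinear (partial (n + Suc k0))" by (rule bounded_clinear_partial)
    show "norm (partial (n + Suc k0) x) \<le> C * norm x" by (rule C)
    show "partial (m + Suc k0) (partial (n + Suc k0) x) = partial (min m n + Suc k0) x"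
      unfolding partial_partial by (metis min_add_distrib_left)
    show "(\<lambda>n. partial (n + Suc k0) x) \<longlonglongrightarrow> x"
      by (rule LIMSEQ_ignore_initial_segment[OF partial_tendsto])
    show "norm (u n) \<le> B" unfolding u_def by (rule bound)
    show "m \<le> n \<Longrightarrow> partial (m + Suc k0) (u n) = u m"
      by (simp add: u_def partial_sum min_def del: add_Suc_right)
    show "\<not> convergent u"
      using div convergent_ignore_initial_segment[of "\<lambda>n. \<Sum>k<n. a k *\<^sub>C e k" "Suc k0"]
      by (simp add: u_def[abs_def])
    show "bounded_clinear g"
    proof -
      have "bounded_linear (\<lambda>x. coef x k0 / a k0)"
        using bounded_clinear_coef[of k0] unfolding bounded_clinear_def
        by (intro bounded_linear_divide[THEN bounded_linear_compose]) simp
      then show ?thesis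
        by (simp add: bounded_clinear_def g_def[abs_def] coef_scaleC scaleC_complex_def)
    qed
    show "g (partial (n + Suc k0) x) = g x" 
      by (simp add: g_def partial_def coef_sum del: sum.lessThan_Suc add_Suc_right)
    show "g (u n) = 1" 
      using k0 by (simp add: g_def u_def coef_sum del: sum.lessThan_Suc add_Suc_right)
  qed
  show ?thesis
    unfolding escaping_operator_def by (rule operator_with_escaping_orbit)
qed

text \<open>
  A vector \<open>x\<close> on whose tail \<open>x - partial N x\<close> the functional is large compared to the norm of \<open>x\<close>
  yields, after truncating the tail far out and normalising, a block beyond \<open>N\<close> of controlled norm;
  iterate from the end of this block.
\<close>

lemma normalised_blocks_if_not_shrinking:
  fixes f :: "'a \<Rightarrow> complex"
  assumes f: "bounded_clinear f" and "\<epsilon> > 0"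
    and bad: "\<forall>N\<ge>M. \<exists>x. norm (f (x - partial N x)) > \<epsilon> * norm x"
  shows "\<exists>B (m :: nat \<Rightarrow> nat) u. strict_mono m \<and> (\<forall>k. partial (m (Suc k)) (u k) = u k \<and>
    partial (m k) (u k) = 0 \<and> f (u k) = 1 \<and> norm (u k) \<le> B)"
proof -
  obtain C where "C \<ge> 0" and C: "\<And>n x. norm (partial n x) \<le> C * norm x"
    using partial_uniformly_bounded by blast
  have fb: "bounded_linear f" using f by (simp add: bounded_clinear_def)
  note fl = bounded_linear.linear[OF fb]
  let ?B = "C * (1 + C) / \<epsilon>"
  let ?P = "\<lambda>N m b. N < m \<and> partial m b = b \<and> partial N b = 0 \<and> f b = 1 \<and> norm b \<le> ?B"
  have step: "\<exists>m b. ?P N m b" if N: "N \<ge> M" for N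
  proof -
    obtain x where x: "norm (f (x - partial N x)) > \<epsilon> * norm x" using bad N by blast
    define y where "y = x - partial N x"
    have "y \<noteq> 0" using x \<open>\<epsilon> > 0\<close> linear_0[OF fl] by (auto simp: y_def[symmetric] mult_less_0_iff)
    then have "x \<noteq> 0" using linear_0[OF partial_linear] by (auto simp: y_def)
    have "(\<lambda>m. norm (f (partial m y))) \<longlonglongrightarrow> norm (f y)"
      by (intro tendsto_norm bounded_linear.tendsto[OF fb] partial_tendsto)
    then have "\<forall>\<^sub>F m in sequentially. norm (f (partial m y)) > \<epsilon> * norm x"
      by (rule order_tendstoD) (use x in \<open>simp add: y_def\<close>)
    then have "\<forall>\<^sub>F m in sequentially. norm (f (partial m y)) > \<epsilon> * norm x \<and> m > N"
      using eventually_gt_at_top by (rule eventually_conj)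
    then obtain m where m: "norm (f (partial m y)) > \<epsilon> * norm x" "m > N"
      by (auto simp: eventually_sequentially)
    have pos: "\<epsilon> * norm x > 0" using \<open>\<epsilon> > 0\<close> \<open>x \<noteq> 0\<close> by simp
    then have ne: "f (partial m y) \<noteq> 0" using m(1) by auto
    define b where "b = (1 / f (partial m y)) *\<^sub>C partial m y"
    have "partial m b = b" by (simp add: b_def partial_scaleC partial_partial)
    moreover have "partial N b = 0"
    proof -
      have "partial N (partial m y) = 0"
        using m(2) by (simp add: partial_partial y_def linear_diff[OF partial_linear])
      then show ?thesis by (simp add: b_def partial_scaleC)
    qed
    moreover have "f b = 1"
      using f ne by (simp add: b_def bounded_clinear_def scaleC_complex_def)
    moreover have "norm b \<le> ?B"
    proof -
      have "norm y \<le> (1 + C) * norm x"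
        using norm_triangle_ineq4[of x "partial N x"] C[of N x] by (simp add: y_def algebra_simps)
      then have "norm (partial m y) \<le> C * ((1 + C) * norm x)"
        using C[of m y] \<open>C \<ge> 0\<close> by (meson mult_left_mono order_trans)
      then have "norm b \<le> C * ((1 + C) * norm x) / norm (f (partial m y))"
        by (simp add: b_def norm_scaleC norm_divide divide_right_mono)
      also have "\<dots> \<le> C * ((1 + C) * norm x) / (\<epsilon> * norm x)"
        using m(1) \<open>C \<ge> 0\<close> ne by (intro divide_left_mono mult_pos_pos pos) auto
      also have "\<dots> = ?B" using \<open>x \<noteq> 0\<close> by simp
      finally show ?thesis .
    qed
    ultimately show ?thesis using m(2) by blast
  qed
  then have "\<forall>N. \<exists>m b. M \<le> N \<longrightarrow> ?P N m b" by blast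
  from choice[OF this] obtain nx where "\<forall>N. \<exists>b. M \<le> N \<longrightarrow> ?P N (nx N) b" by blast
  from choice[OF this] obtain bl where nb: "\<And>N. M \<le> N \<Longrightarrow> ?P N (nx N) (bl N)" by blast
  define m where "m k = (nx ^^ k) M" for k
  have m0: "m 0 = M" and mS: "m (Suc k) = nx (m k)" for k by (simp_all add: m_def)
  have mM: "M \<le> m k" for k
  proof (induction k)
    case (Suc k)
    then show ?case using nb[OF Suc] by (simp add: mS)
  qed (simp add: m0)
  have "strict_mono m"
    using nb[OF mM] by (simp add: strict_mono_Suc_iff mS)
  moreover have "\<forall>k. partial (m (Suc k)) (bl (m k)) = bl (m k) \<and> partial (m k) (bl (m k)) = 0 \<and>
      f (bl (m k)) = 1 \<and> norm (bl (m k)) \<le> ?B"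
    using nb[OF mM] by (simp add: mS)
  ultimately show ?thesis
    by (intro exI[of _ ?B] exI[of _ m] exI[of _ "\<lambda>k. bl (m k)"] conjI)
qed

text \<open>
  The projection \<open>S k\<close> replaces the tail of \<open>x\<close> beyond the block \<open>u k\<close> by the multiple of \<open>u k\<close> with the
  same value of \<open>f\<close>. Thus it preserves \<open>f\<close>, and it maps all later blocks, which are tails with
  value \<open>1\<close>, to \<open>u k\<close>. The blocks diverge: their coordinates tend to \<open>0\<close>, whereas \<open>f\<close> is \<open>1\<close> on them.
\<close>

lemma escaping_operator_if_not_shrinking:
  fixes f :: "'a \<Rightarrow> complex"
  assumes f: "bounded_clinear f" and "\<epsilon> > 0"
    and bad: "\<forall>N\<ge>M. \<exists>x. norm (f (x - partial N x)) > \<epsilon> * norm x"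
  shows "\<exists>A :: 'a \<Rightarrow>\<^sub>C\<^sub>L 'a. escaping_operator A"
proof -
  obtain C where "C \<ge> 0" and C: "\<And>n x. norm (partial n x) \<le> C * norm x"
    using partial_uniformly_bounded by blast
  from normalised_blocks_if_not_shrinking[OF assms] obtain B m u where m: "strict_mono (m :: nat \<Rightarrow> nat)"
    and blocks: "\<forall>k. partial (m (Suc k)) (u k) = u k \<and> partial (m k) (u k) = 0 \<and>
      f (u k) = 1 \<and> norm (u k) \<le> B"
    by (elim exE conjE) (rule that)
  have u: "partial (m (Suc k)) (u k) = u k" "partial (m k) (u k) = 0" "f (u k) = 1"
    "norm (u k) \<le> B" for k
    using blocks by blast+
  have fb: "bounded_linear f" using f by (simp add: bounded_clinear_def)
  note fl = bounded_linear.linear[OF fb]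
  have "B \<ge> 0" using u(4)[of 0] norm_ge_zero order_trans by blast
  have u_low: "partial j (u k) = 0" if "j \<le> m k" for j k
    using partial_partial[of j "m k" "u k"] that linear_0[OF partial_linear]
    by (simp add: u(2) min_def split: if_splits)
  have u_high: "partial j (u k) = u k" if "m (Suc k) \<le> j" for j k
    using partial_partial[of j "m (Suc k)" "u k"] that by (simp add: u(1) min_def split: if_splits)
  define S where "S k x = partial (m (Suc k)) x + f (x - partial (m (Suc k)) x) *\<^sub>C u k" for k x
  have f_S: "f (S n x) = f x" for n x
    using f by (simp add: S_def linear_add[OF fl] linear_diff[OF fl] bounded_clinear_def u(3)
        scaleC_complex_def)
  have S_bound: "norm (S n x) \<le> (C + onorm f * (1 + C) * B) * norm x" for n x
  proof -
    let ?y = "x - partial (m (Suc n)) x"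
    have y: "norm ?y \<le> (1 + C) * norm x"
      using norm_triangle_ineq4[of x "partial (m (Suc n)) x"] C[of "m (Suc n)" x]
      by (simp add: algebra_simps)
    have "norm (f ?y) \<le> onorm f * ((1 + C) * norm x)"
      using onorm[OF fb, of ?y] mult_left_mono[OF y onorm_pos_le[OF fb]] by linarith
    then have "norm (f ?y) * norm (u n) \<le> onorm f * ((1 + C) * norm x) * B"
      using u(4)[of n] \<open>B \<ge> 0\<close> onorm_pos_le[OF fb] \<open>C \<ge> 0\<close> by (intro mult_mono) auto
    moreover have "norm (S n x) \<le> norm (partial (m (Suc n)) x) + norm (f ?y) * norm (u n)"
      unfolding S_def norm_scaleC[symmetric] by (rule norm_triangle_ineq)
    ultimately show ?thesis using C[of "m (Suc n)" x] by (simp add: algebra_simps)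
  qed
  have S_fix: "S k x = x" if "partial (m (Suc k)) x = x" for k x
    using that linear_0[OF fl] by (simp add: S_def)
  interpret escaping_system S u f "C + onorm f * (1 + C) * B" B
  proof
    fix n k x
    show "bounded_clinear (S n)"
    proof (rule bounded_clinearI[OF _ _ S_bound])
      show "S n (x + y) = S n x + S n y" for x y
      proof -
        have "f (x + y - partial j (x + y)) = f (x - partial j x) + f (y - partial j y)" for j
          by (simp add: partial_add linear_add[OF fl] linear_diff[OF fl])
        then show ?thesis by (simp add: S_def partial_add scaleC_add_left add_ac)
      qed
      show "S n (c *\<^sub>C x) = c *\<^sub>C S n x" for c x
      proof -
        have "f (c *\<^sub>C x - partial j (c *\<^sub>C x)) = c * f (x - partial j x)" for j
          using f
          by (simp add: partial_scaleC scaleC_diff_right[symmetric] bounded_clinear_def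
              scaleC_complex_def)
        then show ?thesis by (simp add: S_def partial_scaleC scaleC_add_right scaleC_scaleC)
      qed
    qed
    show "norm (S n x) \<le> (C + onorm f * (1 + C) * B) * norm x" by (rule S_bound)
    show "S k (S n x) = S (min k n) x"
    proof (cases "n \<le> k")
      case True
      then have "m (Suc n) \<le> m (Suc k)" using m by (simp add: strict_mono_less_eq)
      then have "partial (m (Suc k)) (S n x) = S n x"
        using u_high[of n "m (Suc k)"]
        by (simp add: S_def partial_add partial_scaleC partial_partial min_absorb2)
      then have "S k (S n x) = S n x" by (rule S_fix)
      then show ?thesis using True by (simp add: min_def)
    next
      case False
      then have le: "m (Suc k) \<le> m n" "m (Suc k) \<le> m (Suc n)"
        using m by (simp_all add: strict_mono_less_eq)
      then have "partial (m (Suc k)) (S n x) = partial (m (Suc k)) x"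
        using u_low[OF le(1)]
        by (simp add: S_def partial_add partial_scaleC partial_partial min_absorb1)
      then have "S k (S n x) = S k x"
        by (simp add: S_def[of k "S n x"] S_def[of k x] linear_diff[OF fl] f_S)
      then show ?thesis using False by (simp add: min_def)
    qed
    show "(\<lambda>n. S n x) \<longlonglongrightarrow> x"
    proof -
      have P: "(\<lambda>n. partial (m (Suc n)) x) \<longlonglongrightarrow> x"
        using LIMSEQ_Suc[OF LIMSEQ_subseq_LIMSEQ[OF partial_tendsto m]] by (simp add: o_def)
      have "(\<lambda>n. f (x - partial (m (Suc n)) x) *\<^sub>C u n) \<longlonglongrightarrow> 0"
      proof (rule Lim_null_comparison)
        show "\<forall>\<^sub>F n in sequentially. norm (f (x - partial (m (Suc n)) x) *\<^sub>C u n)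
            \<le> norm (f (x - partial (m (Suc n)) x)) * B"
          using u(4) by (simp add: norm_scaleC mult_left_mono)
        have "(\<lambda>n. norm (f (x - partial (m (Suc n)) x)) * B) \<longlonglongrightarrow> norm (f (x - x)) * B"
          by (intro tendsto_intros bounded_linear.tendsto[OF fb] P)
        then show "(\<lambda>n. norm (f (x - partial (m (Suc n)) x)) * B) \<longlonglongrightarrow> 0"
          using linear_0[OF fl] by simp
      qed
      from tendsto_add[OF P this] show ?thesis by (simp add: S_def)
    qed
    show "norm (u n) \<le> B" by (rule u(4))
    show "S k (u n) = u k" if "k \<le> n"
    proof (cases "k = n")
      case True
      then show ?thesis by (simp add: S_fix u(1))
    next
      case False
      then have "m (Suc k) \<le> m n" using that m by (simp add: strict_mono_less_eq)
      then show ?thesis by (simp add: S_def u_low u(3) scaleC_one)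
    qed
    show "\<not> convergent u"
    proof
      assume "convergent u"
      then obtain l where l: "u \<longlonglongrightarrow> l" by (auto simp: convergent_def)
      have "partial N l = 0" for N
      proof (rule LIMSEQ_unique)
        show "(\<lambda>n. partial N (u n)) \<longlonglongrightarrow> partial N l"
          by (rule bounded_linear.tendsto[OF _ l])
            (use bounded_clinear_partial[of N] in \<open>simp add: bounded_clinear_def\<close>)
        have "\<forall>\<^sub>F n in sequentially. partial N (u n) = 0"
          by (rule eventually_sequentiallyI[of N], rule u_low) (rule order_trans[OF _ seq_suble[OF m]])
        then show "(\<lambda>n. partial N (u n)) \<longlonglongrightarrow> 0" by (rule tendsto_eventually)
      qed
      then have "l = 0" using LIMSEQ_unique[OF partial_tendsto[of l], of 0] by simp
      then have "(\<lambda>n. f (u n)) \<longlonglongrightarrow> 0"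
        using bounded_linear.tendsto[OF fb l] linear_0[OF fl] by simp
      then show False by (simp add: u(3) LIMSEQ_const_iff)
    qed
    show "bounded_clinear f" by (rule f)
    show "f (S n x) = f x" by (rule f_S)
    show "f (u n) = 1" by (rule u(3))
  qed
  show ?thesis
    unfolding escaping_operator_def by (rule operator_with_escaping_orbit)
qed

text \<open>
  James's criterion. The coordinates \<open>a k\<close> of \<open>\<Phi>\<close> have bounded partial sums \<open>s n\<close>, because \<open>s n\<close> is the
  image of \<open>\<Phi>\<close> under the bidual of \<open>partial n\<close>; so they converge to some \<open>l\<close>. As the basis is
  shrinking, \<open>f \<circ> partial N\<close> is close to \<open>f\<close> in norm for suitable large \<open>N\<close>, whence \<open>\<Phi> f = f l\<close>.
\<close>

lemma reflexive_if_shrinking_boundedly_complete: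
  assumes shrinking: "\<And>f :: 'a cdual. \<And>\<epsilon> M. \<epsilon> > 0 \<Longrightarrow>
      \<exists>N\<ge>M. \<forall>x. norm (cblinfun_apply f (x - partial N x)) \<le> \<epsilon> * norm x"
    and complete: "\<And>a B. (\<And>n. norm (\<Sum>k<n. a k *\<^sub>C e k) \<le> B) \<Longrightarrow>
      convergent (\<lambda>n. \<Sum>k<n. a k *\<^sub>C e k)"
  shows "reflexive_space TYPE('a)"
proof -
  obtain C where "C \<ge> 0" and C: "\<And>n x. norm (partial n x) \<le> C * norm x"
    using partial_uniformly_bounded by blast
  have surj: "\<exists>s. \<Phi> = canonical_embedding s" for \<Phi> :: "'a cdual cdual"
  proof -
    define E where "E k = CBlinfun (\<lambda>x. coef x k)" for k
    have E: "cblinfun_apply (E k) x = coef x k" for k x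
      using bounded_clinear_coef[of k] by (simp add: E_def CBlinfun_inverse)
    define a where "a k = cblinfun_apply \<Phi> (E k)" for k
    define s where "s n = (\<Sum>k<n. a k *\<^sub>C e k)" for n
    \<comment> \<open>The functional \<open>f \<circ> partial n\<close>, as a combination of coordinate functionals.\<close>
    define R where "R f n = (\<Sum>k<n. cblinfun_apply f (e k) *\<^sub>C E k)" for f :: "'a cdual" and n
    have apply_sum: "cblinfun_apply (\<Sum>k\<in>A. h k) x = (\<Sum>k\<in>A. cblinfun_apply (h k) x)"
      for A and h :: "nat \<Rightarrow> 'a cdual" and x
      using linear_sum[OF bounded_linear.linear[OF bounded_linear_cblinfun_apply],
          of "canonical_embedding x" h A]
      by (simp add: canonical_embedding.rep_eq)
    have R: "cblinfun_apply (R f n) x = cblinfun_apply f (partial n x)" for f n x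
      by (simp add: R_def apply_sum scaleC_cblinfun.rep_eq E partial_def scaleC_complex_def
          linear_sum[OF bounded_linear.linear[OF bounded_linear_cblinfun_apply]]
          cblinfun_apply_scaleC mult.commute)
    have \<Phi>_R: "cblinfun_apply \<Phi> (R f n) = cblinfun_apply f (s n)" for f n
      by (simp add: R_def s_def a_def scaleC_complex_def cblinfun_apply_scaleC mult.commute
          linear_sum[OF bounded_linear.linear[OF bounded_linear_cblinfun_apply]])
    have "norm (s n) \<le> norm \<Phi> * C" for n
    proof -
      obtain f :: "'a cdual" where f: "norm f \<le> 1" "Re (cblinfun_apply f (s n)) = norm (s n)"
        by (rule norming_functional)
      have "norm (R f n) \<le> C"
      proof (rule norm_cblinfun_bound[OF \<open>C \<ge> 0\<close>])
        fix x
        have "norm (cblinfun_apply (R f n) x) \<le> norm f * norm (partial n x)"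
          unfolding R by (rule norm_cblinfun)
        also have "\<dots> \<le> 1 * (C * norm x)"
          by (intro mult_mono f C) auto
        finally show "norm (cblinfun_apply (R f n) x) \<le> C * norm x" by simp
      qed
      then have "norm (cblinfun_apply \<Phi> (R f n)) \<le> norm \<Phi> * C"
        using norm_cblinfun[of \<Phi> "R f n"] by (meson mult_left_mono norm_ge_zero order_trans)
      then show ?thesis
        using f(2) complex_Re_le_cmod[of "cblinfun_apply f (s n)"] by (simp add: \<Phi>_R)
    qed
    then have "convergent s" unfolding s_def by (rule complete)
    then obtain l where l: "s \<longlonglongrightarrow> l" by (auto simp: convergent_def)
    have "cblinfun_apply \<Phi> f = cblinfun_apply f l" for f
    proof -
      have "norm (cblinfun_apply \<Phi> f - cblinfun_apply f l) \<le> 0 + \<epsilon>" if "\<epsilon> > 0" for \<epsilon>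
      proof -
        define \<delta> where "\<delta> = \<epsilon> / (2 * (norm \<Phi> + 1))"
        have p: "norm \<Phi> + 1 > 0" by (simp add: add_nonneg_pos)
        have \<delta>: "\<delta> > 0" using that p by (simp add: \<delta>_def)
        have "(\<lambda>n. cblinfun_apply f (s n)) \<longlonglongrightarrow> cblinfun_apply f l"
          by (rule bounded_linear.tendsto[OF bounded_linear_cblinfun_apply l])
        from LIMSEQ_D[OF this half_gt_zero[OF that]]
        obtain M where M: "\<And>n. n \<ge> M \<Longrightarrow> norm (cblinfun_apply f (s n) - cblinfun_apply f l) < \<epsilon> / 2"
          by blast
        obtain N where N: "N \<ge> M" "\<And>x. norm (cblinfun_apply f (x - partial N x)) \<le> \<delta> * norm x"
          using shrinking[OF \<delta>, of M f] by blast
        have "norm (f - R f N) \<le> \<delta>"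
        proof (rule norm_cblinfun_bound)
          show "norm (cblinfun_apply (f - R f N) x) \<le> \<delta> * norm x" for x
            using N(2)[of x]
            by (simp add: minus_cblinfun.rep_eq R
                linear_diff[OF bounded_linear.linear[OF bounded_linear_cblinfun_apply]])
        qed (use \<delta> in simp)
        then have "norm (cblinfun_apply \<Phi> (f - R f N)) \<le> norm \<Phi> * \<delta>"
          using norm_cblinfun[of \<Phi> "f - R f N"] by (meson mult_left_mono norm_ge_zero order_trans)
        also have "\<dots> \<le> (norm \<Phi> + 1) * \<delta>" using \<delta> by (intro mult_right_mono) auto
        also have "\<dots> = \<epsilon> / 2"
        proof -
          have "c * (\<epsilon> / (2 * c)) = \<epsilon> / 2" if "c > 0" for c using that by simp
          then show ?thesis unfolding \<delta>_def using p by blast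
        qed
        finally have "norm (cblinfun_apply \<Phi> f - cblinfun_apply f (s N)) \<le> \<epsilon> / 2"
          by (simp add: linear_diff[OF bounded_linear.linear[OF bounded_linear_cblinfun_apply]] \<Phi>_R)
        then show ?thesis
          using norm_triangle_ineq[of "cblinfun_apply \<Phi> f - cblinfun_apply f (s N)"
              "cblinfun_apply f (s N) - cblinfun_apply f l"] M[OF N(1)] by simp
      qed
      then have "norm (cblinfun_apply \<Phi> f - cblinfun_apply f l) \<le> 0" by (rule field_le_epsilon)
      then show ?thesis by simp
    qed
    then have "\<Phi> = canonical_embedding l"
      by (simp add: canonical_embedding.rep_eq fun_eq_iff flip: cblinfun_apply_inject)
    then show ?thesis by blast
  qed
  then show ?thesis unfolding reflexive_space_def surj_def by (rule allI)
qed

theorem nonreflexive_escaping_operator: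
  assumes "\<not> reflexive_space TYPE('a)"
  shows "\<exists>A :: 'a \<Rightarrow>\<^sub>C\<^sub>L 'a. escaping_operator A"
proof (rule ccontr)
  assume none: "\<not> ?thesis"
  have "reflexive_space TYPE('a)"
  proof (rule reflexive_if_shrinking_boundedly_complete)
    fix f :: "'a cdual" and \<epsilon> :: real and M :: nat
    assume "\<epsilon> > 0"
    show "\<exists>N\<ge>M. \<forall>x. norm (cblinfun_apply f (x - partial N x)) \<le> \<epsilon> * norm x"
    proof (rule ccontr)
      assume *: "\<not> ?thesis"
      have "\<exists>A :: 'a \<Rightarrow>\<^sub>C\<^sub>L 'a. escaping_operator A"
      proof (rule escaping_operator_if_not_shrinking[OF _ \<open>\<epsilon> > 0\<close>])
        show "bounded_clinear (cblinfun_apply f)" using cblinfun_apply[of f] by simp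
        show "\<forall>N\<ge>M. \<exists>x. norm (cblinfun_apply f (x - partial N x)) > \<epsilon> * norm x"
          using * by (meson not_le)
      qed
      then show False using none by blast
    qed
  next
    fix a B assume "\<And>n. norm (\<Sum>k<n. a k *\<^sub>C e k) \<le> B"
    then show "convergent (\<lambda>n. \<Sum>k<n. a k *\<^sub>C e k)"
      using none escaping_operator_if_not_boundedly_complete by blast
  qed
  then show False using assms by blast
qed

end

section \<open>Mean ergodicity on reflexive spaces\<close>

text \<open>
  \<open>Inf (U f)\<close> is the limes superior of the real parts of \<open>f (a n)\<close>.
\<close>

lemma sublinear_eventual_upper_bound:
  fixes a :: "nat \<Rightarrow> 'a::complex_normed_vector"
  assumes K: "\<And>n. norm (a n) \<le> K"
  defines "U \<equiv> \<lambda>f :: 'a cdual. {r. \<forall>\<^sub>F n in sequentially. Re (cblinfun_apply f (a n)) \<le> r}"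
  shows "sublinear (\<lambda>f. Inf (U f))" "\<And>f r. r \<in> U f \<Longrightarrow> Inf (U f) \<le> r" "\<And>f. norm f * K \<in> U f"
proof -
  have bound: "\<bar>Re (cblinfun_apply f (a n))\<bar> \<le> norm f * K" for f n
    using abs_Re_le_cmod[of "cblinfun_apply f (a n)"] norm_cblinfun[of f "a n"]
      mult_left_mono[OF K[of n] norm_ge_zero[of f]] by linarith
  show mem: "norm f * K \<in> U f" for f
    using bound[of f] by (simp add: U_def abs_le_iff)
  have lower: "- (norm f * K) \<le> r" if "r \<in> U f" for f r
  proof -
    obtain n where "Re (cblinfun_apply f (a n)) \<le> r"
      using \<open>r \<in> U f\<close> by (auto simp: U_def eventually_sequentially)
    then show ?thesis using bound[of f n] by linarith
  qed
  have bdd: "bdd_below (U f)" for f by (rule bdd_belowI[OF lower])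
  show le: "Inf (U f) \<le> r" if "r \<in> U f" for f r by (rule cInf_lower[OF that bdd])
  have ge: "c \<le> Inf (U f)" if "\<And>r. r \<in> U f \<Longrightarrow> c \<le> r" for c f
    using mem[of f] by (intro cInf_greatest that) auto
  show "sublinear (\<lambda>f. Inf (U f))"
    unfolding sublinear_def
  proof (intro conjI allI impI)
    fix f h :: "'a cdual"
    have *: "Inf (U (f + h)) \<le> r + s" if "r \<in> U f" "s \<in> U h" for r s
    proof (rule le)
      have "\<forall>\<^sub>F n in sequentially. Re (cblinfun_apply f (a n)) \<le> r \<and> Re (cblinfun_apply h (a n)) \<le> s"
        using that by (simp add: U_def eventually_conj)
      then show "r + s \<in> U (f + h)"
        unfolding U_def by (auto elim!: eventually_mono simp: plus_cblinfun.rep_eq)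
    qed
    have "Inf (U (f + h)) - Inf (U h) \<le> r" if "r \<in> U f" for r
    proof -
      have "Inf (U (f + h)) - r \<le> Inf (U h)"
        by (rule ge) (use *[OF that] in \<open>simp add: algebra_simps\<close>)
      then show ?thesis by simp
    qed
    then have "Inf (U (f + h)) - Inf (U h) \<le> Inf (U f)" by (rule ge)
    then show "Inf (U (f + h)) \<le> Inf (U f) + Inf (U h)" by simp
  next
    fix c :: real and f :: "'a cdual" assume c: "c > 0"
    have "Inf (U (c *\<^sub>R f)) / c \<le> r" if "r \<in> U f" for r
    proof -
      have "c * r \<in> U (c *\<^sub>R f)"
        using that c by (auto simp: U_def scaleR_cblinfun.rep_eq elim!: eventually_mono)
      then show ?thesis using le[of "c * r" "c *\<^sub>R f"] c by (simp add: field_simps)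
    qed
    then have "Inf (U (c *\<^sub>R f)) / c \<le> Inf (U f)" by (rule ge)
    then show "Inf (U (c *\<^sub>R f)) \<le> c * Inf (U f)" using c by (simp add: field_simps)
  qed
qed

text \<open>
  A linear functional on the dual below this limes superior is a generalised limit of the \<open>a n\<close> in
  the bidual; by reflexivity it is evaluation at a point.
\<close>

lemma reflexive_weak_cluster_point:
  fixes a :: "nat \<Rightarrow> 'a::complex_normed_vector"
  assumes refl: "reflexive_space TYPE('a)" and K: "\<And>n. norm (a n) \<le> K"
  shows "\<exists>x0. \<forall>(f :: 'a cdual) r. (\<forall>\<^sub>F n in sequentially. Re (cblinfun_apply f (a n)) \<le> r)
    \<longrightarrow> Re (cblinfun_apply f x0) \<le> r"
proof -
  have "K \<ge> 0" using K[of 0] norm_ge_zero order_trans by blast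
  define p where "p = (\<lambda>f :: 'a cdual.
    Inf {r. \<forall>\<^sub>F n in sequentially. Re (cblinfun_apply f (a n)) \<le> r})"
  have p: "sublinear p"
    and p_le: "\<And>f r. \<forall>\<^sub>F n in sequentially. Re (cblinfun_apply f (a n)) \<le> r \<Longrightarrow> p f \<le> r"
    and p_norm: "\<And>f. p f \<le> norm f * K"
    using sublinear_eventual_upper_bound[of a K] K unfolding p_def by auto
  obtain h where h: "linear h" "\<And>f. h f \<le> p f"
    using sublinear_dominates_linear[OF p] by metis
  have "h f \<le> K * norm f" for f
    using h(2)[of f] p_norm[of f] by (simp add: mult.commute)
  then obtain \<Phi> :: "'a cdual cdual" where \<Phi>: "\<And>f. Re (cblinfun_apply \<Phi> f) = h f"
    using cdual_of_real_part[OF h(1) _ \<open>K \<ge> 0\<close>] by blast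
  obtain x0 where "\<Phi> = canonical_embedding x0"
    using refl unfolding reflexive_space_def surj_def by blast
  then have "Re (cblinfun_apply f x0) = h f" for f
    using \<Phi>[of f] by (simp add: canonical_embedding.rep_eq)
  then show ?thesis using order_trans[OF h(2) p_le]
    by (intro exI[of _ x0] allI impI) simp
qed

lemma relatively_compactI_approx:
  fixes S :: "'a::complete_space set"
  assumes "\<And>\<epsilon>. \<epsilon> > 0 \<Longrightarrow> \<exists>K. compact K \<and> (\<forall>s\<in>S. \<exists>k\<in>K. dist s k < \<epsilon>)"
  shows "relatively_compact S"
  unfolding relatively_compact_def compact_eq_totally_bounded
proof (intro conjI allI impI)
  show "complete (closure S)" by (simp add: complete_eq_closed)
  fix \<epsilon> :: real assume "\<epsilon> > 0"
  then have "\<epsilon> / 3 > 0" by simp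
  from assms[OF this] obtain K where K: "compact K" "\<forall>s\<in>S. \<exists>k\<in>K. dist s k < \<epsilon> / 3" by blast
  obtain F where F: "finite F" "K \<subseteq> (\<Union>x\<in>F. ball x (\<epsilon> / 3))"
    using K(1) \<open>\<epsilon> / 3 > 0\<close> unfolding compact_eq_totally_bounded by blast
  have "y \<in> (\<Union>x\<in>F. ball x \<epsilon>)" if "y \<in> closure S" for y
  proof -
    obtain s where s: "s \<in> S" "dist s y < \<epsilon> / 3"
      using \<open>y \<in> closure S\<close> \<open>\<epsilon> / 3 > 0\<close> unfolding closure_approachable by blast
    obtain k where k: "k \<in> K" "dist s k < \<epsilon> / 3" using K(2) s(1) by blast
    obtain x where x: "x \<in> F" "dist x k < \<epsilon> / 3" using F(2) k(1) by auto
    have "dist x y < \<epsilon>"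
      using dist_triangle[of x y k] dist_triangle[of k y s] s(2) k(2) x(2)
      by (simp add: dist_commute)
    then show ?thesis using x(1) by auto
  qed
  then show "\<exists>k. finite k \<and> closure S \<subseteq> (\<Union>x\<in>k. ball x \<epsilon>)" using F(1) by blast
qed

lemma bounded_linear_cblinfun_funpow:
  fixes T :: "'a::complex_normed_vector \<Rightarrow>\<^sub>C\<^sub>L 'a"
  shows "bounded_linear (cblinfun_apply T ^^ n)"
proof (induction n)
  case 0
  show ?case by (simp add: id_def bounded_linear_ident)
next
  case (Suc n)
  show ?case
    using bounded_linear_compose[OF bounded_linear_cblinfun_apply Suc] by (simp add: o_def)
qed

lemma power_bounded_imp_bound:
  assumes "power_bounded T"
  shows "\<exists>K\<ge>0. \<forall>n x. norm ((cblinfun_apply T ^^ n) x) \<le> K * norm x"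
proof -
  note bl = bounded_linear_cblinfun_funpow[of _ T]
  obtain K where K: "\<And>n. onorm (cblinfun_apply T ^^ n) \<le> K"
    using assms unfolding power_bounded_def bdd_above_def by auto
  have "K \<ge> 0" using onorm_pos_le[OF bl] K order_trans by blast
  moreover have "norm ((cblinfun_apply T ^^ n) x) \<le> K * norm x" for n x
    using onorm[OF bl, of n x] mult_right_mono[OF K[of n] norm_ge_zero[of x]] by linarith
  ultimately show ?thesis by blast
qed

text \<open>
  \<open>x\<^sub>0\<close> is a weak cluster point of the Cesaro means \<open>a n\<close>. It is fixed because \<open>T (a n) - a n\<close> tends to
  \<open>0\<close>, and \<open>x - x\<^sub>0\<close> lies in the closure because every \<open>x - a n\<close> lies in the range of \<open>1 - T\<close> and
  closed subspaces are weakly closed.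
\<close>

lemma mean_ergodic_decomposition:
  fixes T :: "'a::complex_normed_vector \<Rightarrow>\<^sub>C\<^sub>L 'a"
  assumes refl: "reflexive_space TYPE('a)" and pb: "power_bounded T"
  shows "\<exists>x0. cblinfun_apply T x0 = x0 \<and>
    x - x0 \<in> closure (range (\<lambda>z. z - cblinfun_apply T z))"
proof -
  let ?T = "cblinfun_apply T"
  note Tl = bounded_linear.linear[OF bounded_linear_cblinfun_apply]
  let ?Y = "range (\<lambda>z. z - ?T z)"
  obtain K where K: "K \<ge> 0" "\<And>n x. norm ((?T ^^ n) x) \<le> K * norm x"
    using power_bounded_imp_bound[OF pb] by blast
  define a where "a n = (1 / real (Suc n)) *\<^sub>R (\<Sum>j<Suc n. (?T ^^ j) x)" for n
  have sub: "subspace ?Y"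
    by (rule linear_subspace_image[where S = UNIV, OF linear_compose_sub[OF linear_ident Tl]]) simp
  have a_bound: "norm (a n) \<le> K * norm x" for n
  proof -
    have "norm (\<Sum>j<Suc n. (?T ^^ j) x) \<le> (\<Sum>j<Suc n. K * norm x)"
      by (rule sum_norm_le) (rule K(2))
    then show ?thesis by (simp add: a_def field_simps del: sum.lessThan_Suc)
  qed
  have a_shift: "?T (a n) - a n = (1 / real (Suc n)) *\<^sub>R ((?T ^^ Suc n) x - x)" for n
  proof -
    have "?T (\<Sum>j<Suc n. (?T ^^ j) x) = (\<Sum>j<Suc n. (?T ^^ Suc j) x)"
      by (simp add: linear_sum[OF Tl] del: sum.lessThan_Suc)
    then have "?T (\<Sum>j<Suc n. (?T ^^ j) x) - (\<Sum>j<Suc n. (?T ^^ j) x)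
        = (\<Sum>j<Suc n. (?T ^^ Suc j) x - (?T ^^ j) x)"
      by (simp only: sum_subtractf)
    also have "\<dots> = (?T ^^ Suc n) x - x"
      using sum_lessThan_telescope[of "\<lambda>j. (?T ^^ j) x" "Suc n"] by simp
    finally show ?thesis
      by (simp add: a_def linear_scale[OF Tl] flip: scaleR_right_diff_distrib
          del: sum.lessThan_Suc funpow.simps)
  qed
  have diff_pow: "x - (?T ^^ j) x \<in> ?Y" for j
  proof (induction j)
    case 0
    show ?case using subspace_0[OF sub] by simp
  next
    case (Suc j)
    have "(?T ^^ j) x - ?T ((?T ^^ j) x) \<in> ?Y" by blast
    from subspace_add[OF sub Suc this] show ?case by simp
  qed
  have diff_a: "x - a n \<in> ?Y" for n
  proof -
    have "x - a n = (1 / real (Suc n)) *\<^sub>R (\<Sum>j<Suc n. x - (?T ^^ j) x)"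
      by (simp add: a_def sum_subtractf scaleR_right_diff_distrib sum_constant_scaleR
          del: sum.lessThan_Suc)
    then show ?thesis
      by (simp only:) (intro subspace_scale[OF sub] subspace_sum[OF sub] diff_pow)
  qed
  obtain x0 where x0: "\<And>(f :: 'a cdual) r. \<forall>\<^sub>F n in sequentially. Re (cblinfun_apply f (a n)) \<le> r
      \<Longrightarrow> Re (cblinfun_apply f x0) \<le> r"
    using reflexive_weak_cluster_point[of a, OF refl a_bound] by blast
  have "?T x0 = x0"
  proof -
    obtain f :: "'a cdual" where f: "Re (cblinfun_apply f (?T x0 - x0)) = norm (?T x0 - x0)"
      by (rule norming_functional)
    note fb = bounded_linear_cblinfun_apply[of f]
    note fl = bounded_linear.linear[OF fb]
    define h where "h = CBlinfun (\<lambda>y. cblinfun_apply f (?T y - y))"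
    have "bounded_clinear (\<lambda>y. cblinfun_apply f (?T y - y))"
      unfolding bounded_clinear_def
      by (auto intro!: bounded_linear_compose[OF fb] bounded_linear_sub bounded_linear_ident
          bounded_linear_cblinfun_apply simp: cblinfun_apply_scaleC simp flip: scaleC_diff_right)
    then have h: "cblinfun_apply h y = cblinfun_apply f (?T y - y)" for y
      by (simp add: h_def CBlinfun_inverse)
    have "(\<lambda>n. ?T (a n) - a n) \<longlonglongrightarrow> 0"
    proof (rule Lim_null_comparison)
      show "\<forall>\<^sub>F n in sequentially. norm (?T (a n) - a n)
          \<le> (1 / real (Suc n)) * (K * norm x + norm x)"
      proof (intro always_eventually allI)
        fix n
        have "norm ((?T ^^ Suc n) x - x) \<le> K * norm x + norm x"
          using norm_triangle_ineq4[of "(?T ^^ Suc n) x" x] K(2)[of "Suc n" x] by linarith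
        then show "norm (?T (a n) - a n) \<le> (1 / real (Suc n)) * (K * norm x + norm x)"
          unfolding a_shift by (simp add: divide_right_mono del: funpow.simps)
      qed
      show "(\<lambda>n. (1 / real (Suc n)) * (K * norm x + norm x)) \<longlonglongrightarrow> 0"
        by (rule tendsto_mult_left_zero) (rule LIMSEQ_Suc[OF lim_1_over_n])
    qed
    then have "(\<lambda>n. Re (cblinfun_apply h (a n))) \<longlonglongrightarrow> Re (cblinfun_apply f 0)"
      unfolding h by (intro tendsto_Re bounded_linear.tendsto[OF fb])
    then have lim: "(\<lambda>n. Re (cblinfun_apply h (a n))) \<longlonglongrightarrow> 0" using linear_0[OF fl] by simp
    have "Re (cblinfun_apply h x0) \<le> 0 + \<epsilon>" if "\<epsilon> > 0" for \<epsilon>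
    proof (rule x0)
      have "\<forall>\<^sub>F n in sequentially. Re (cblinfun_apply h (a n)) < 0 + \<epsilon>"
        by (rule order_tendstoD(2)[OF lim]) (use that in simp)
      then show "\<forall>\<^sub>F n in sequentially. Re (cblinfun_apply h (a n)) \<le> 0 + \<epsilon>"
        by (rule eventually_mono) simp
    qed
    then have "Re (cblinfun_apply h x0) \<le> 0" by (rule field_le_epsilon)
    then show ?thesis using f by (simp add: h)
  qed
  moreover have "x - x0 \<in> closure ?Y"
  proof (rule ccontr)
    assume "x - x0 \<notin> closure ?Y"
    from separating_functional[OF sub this]
    obtain f :: "'a cdual" where f: "\<And>y. y \<in> ?Y \<Longrightarrow> Re (cblinfun_apply f y) = 0"
      "Re (cblinfun_apply f (x - x0)) > 0"
      by blast
    note fl = bounded_linear.linear[OF bounded_linear_cblinfun_apply[of f]]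
    have "Re (cblinfun_apply f (a n)) = Re (cblinfun_apply f x)" for n
      using f(1)[OF diff_a[of n]] by (simp add: linear_diff[OF fl])
    then have "Re (cblinfun_apply (- f) x0) \<le> - Re (cblinfun_apply f x)"
      by (intro x0) (simp add: uminus_cblinfun.rep_eq)
    then show False using f(2) by (simp add: uminus_cblinfun.rep_eq linear_diff[OF fl])
  qed
  ultimately show ?thesis by blast
qed

text \<open>
  If \<open>z - T z\<close> is close to \<open>x - x\<^sub>0\<close>, the orbit of \<open>x\<close> stays uniformly close to the orbit of
  \<open>x\<^sub>0 + z - T z\<close>, which is a translate of the negated differences of the orbit of \<open>z\<close>.
\<close>

theorem reflexive_almost_periodic:
  fixes T :: "'a::complex_banach \<Rightarrow>\<^sub>C\<^sub>L 'a"
  assumes refl: "reflexive_space TYPE('a)" and pb: "power_bounded T"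
    and diffs: "\<And>x. relatively_compact
      (range (\<lambda>n. (cblinfun_apply T ^^ (n + 1)) x - (cblinfun_apply T ^^ n) x))"
  shows "almost_periodic T"
  unfolding almost_periodic_def
proof
  fix x
  let ?T = "cblinfun_apply T"
  obtain K where K: "K \<ge> 0" "\<And>n x. norm ((?T ^^ n) x) \<le> K * norm x"
    using power_bounded_imp_bound[OF pb] by blast
  note pl = bounded_linear.linear[OF bounded_linear_cblinfun_funpow[of _ T]]
  obtain x0 where x0: "?T x0 = x0" "x - x0 \<in> closure (range (\<lambda>z. z - ?T z))"
    using mean_ergodic_decomposition[OF refl pb] by blast
  have fixed: "(?T ^^ n) x0 = x0" for n by (induction n) (auto simp: x0(1))
  show "relatively_compact (range (\<lambda>n. (?T ^^ n) x))"
  proof (rule relatively_compactI_approx)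
    fix \<epsilon> :: real assume "\<epsilon> > 0"
    have "\<epsilon> / (K + 1) > 0" using \<open>\<epsilon> > 0\<close> K(1) by simp
    then obtain z where z: "norm (z - ?T z - (x - x0)) < \<epsilon> / (K + 1)"
      using x0(2) unfolding closure_approachable dist_norm by blast
    let ?D = "closure (range (\<lambda>n. (?T ^^ (n + 1)) z - (?T ^^ n) z))"
    let ?K = "(\<lambda>d. x0 - d) ` ?D"
    have "compact ?K"
      using diffs[of z] unfolding relatively_compact_def
      by (intro compact_continuous_image continuous_intros)
    moreover have "\<exists>k\<in>?K. dist s k < \<epsilon>" if s: "s \<in> range (\<lambda>n. (?T ^^ n) x)" for s
    proof -
      obtain n where n: "s = (?T ^^ n) x" using s by blast
      let ?d = "(?T ^^ (n + 1)) z - (?T ^^ n) z"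
      have d: "?d \<in> ?D" by (intro subsetD[OF closure_subset] rangeI)
      have "s - (x0 - ?d) = (?T ^^ n) ((x - x0) - (z - ?T z))"
      proof -
        have "(?T ^^ (n + 1)) z = (?T ^^ n) (?T z)" by (simp add: funpow_swap1)
        then show ?thesis by (simp only: n linear_diff[OF pl] fixed) (simp add: algebra_simps)
      qed
      then have "norm (s - (x0 - ?d)) \<le> K * norm ((x - x0) - (z - ?T z))" by (simp only: K(2))
      also have "\<dots> \<le> (K + 1) * norm ((x - x0) - (z - ?T z))"
        by (rule mult_right_mono) auto
      also have "\<dots> < (K + 1) * (\<epsilon> / (K + 1))"
        using z K(1) by (intro mult_strict_left_mono) (auto simp: norm_minus_commute)
      also have "\<dots> = \<epsilon>" using K(1) by simp
      finally show ?thesis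
        using d by (intro bexI[of _ "x0 - ?d"] imageI) (simp_all only: dist_norm)
    qed
    ultimately show "\<exists>K. compact K \<and> (\<forall>s\<in>range (\<lambda>n. (?T ^^ n) x). \<exists>k\<in>K. dist s k < \<epsilon>)"
      by blast
  qed
qed

section \<open>The characterisation of reflexivity\<close>

theorem theoremA:
  assumes "\<exists>e :: nat \<Rightarrow> 'a::complex_banach. schauder_basis e"
  shows "reflexive_space TYPE('a) \<longleftrightarrow>
    (\<forall>T :: 'a \<Rightarrow>\<^sub>C\<^sub>L 'a.
       power_bounded T \<and>
       (\<forall>x. relatively_compact
          (range (\<lambda>n::nat. (cblinfun_apply T ^^ (n + 1)) x - (cblinfun_apply T ^^ n) x)))
       \<longrightarrow> almost_periodic T)"
proof -
  obtain e :: "nat \<Rightarrow> 'a" where "schauder_basis e" using assms by blast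
  then interpret basis_expansion e by unfold_locales
  show ?thesis
    using nonreflexive_escaping_operator reflexive_almost_periodic
    unfolding escaping_operator_def by blast
qed

end
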